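(* Let $w\in F$, let $|w|_F$ be the word length of $w$ in Thompson's group $F$ with respect to the generating set $\{x_0,x_1\}$, let $|w|_T$ be the word length of $w$ in Thompson's group $T$ with respect to the generating set $\{x_0,x_1,c_0\}$, and let $N(w)$ be the number of carets in either tree of the reduced tree pair diagram of $w$. If $N(w)\ge |w|_F+1$, then $|w|_T=|w|_F$.
   Context: Thompson's group $T$ is the group of orientation-preserving piecewise-linear homeomorphisms of $S^1=[0,1]/(0\sim 1)$ with finitely many breakpoints, all slopes powers of $2$, and dyadic breakpoints, mapping dyadic rationals to dyadic rationals. $F\subset T$ is the subgroup of elements that are such homeomorphisms of $[0,1]$ (fixing $0$). Product convention: $vu=v\circ u$. Generators: $x_0(t)=t/2$ on $[0,\frac12]$, $t-\frac14$ on $[\frac12,\frac34]$, $2t-1$ on $[\frac34,1]$; $x_1$ is the identity on $[0,\frac12]$ and $x_1(t)=\frac12+\frac12x_0(2t-1)$ on $[\frac12,1]$; $c_0(t)=t+\frac12 \bmod 1$. The set $\{x_0,x_1\}$ generates $F$ and $\{x_0,x_1,c_0\}$ generates $T$. A caret is an interior node of a finite rooted binary tree together with its two downward edges; such a tree encodes a dyadic subdivision of $[0,1]$ whose subintervals are the leaves, numbered $0,1,\dots$ from left to right. A tree pair diagram $(T_-,T_+)$ for $w\in F$ is a pair of such trees with the same number of leaves such that $w$ maps the $a$-th leaf interval of $T_-$ affinely onto the $a$-th leaf interval of $T_+$ for all $a$. It is reduced if there is no $a$ such that both trees have a caret whose two children are the leaves $a,a+1$. Each $w\in F$ has a unique reduced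 diagram. *)

theory Defs
  imports Complex_Main "HOL-Algebra.Bij"
begin

text \<open>The circle \<open>[0,1]/(0 \<sim> 1)\<close> is represented by its fundamental domain \<open>[0,1)\<close>.\<close>

definition circle :: "real set" where
  "circle = {0..<1}"

definition dyadic :: "real set" where
  "dyadic = {x. \<exists>(k::int) (n::nat). x = of_int k / 2 ^ n}"

text \<open>A lift to the real line of an orientation-preserving homeomorphism of \<open>\<real>/\<int>\<close>
  that is piecewise linear, with finitely many breakpoints, all of them dyadic, slopes that
  are powers of 2, and that maps dyadic rationals to dyadic rationals. Because
  \<open>g (t + 1) = g t + 1\<close>, it suffices to look at the linear pieces inside \<open>[0,1]\<close>. Not every
  point of \<open>P\<close> has to be an actual breakpoint. Surjectivity of \<open>g\<close> follows from continuity
  and \<open>g (t + 1) = g t + 1\<close>.\<close>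

definition dyadic_PL_lift :: "(real \<Rightarrow> real) \<Rightarrow> bool" where
  "dyadic_PL_lift g \<longleftrightarrow>
     strict_mono g \<and> continuous_on UNIV g \<and> (\<forall>t. g (t + 1) = g t + 1) \<and>
     (\<exists>P. finite P \<and> P \<subseteq> dyadic \<and>
        (\<forall>a b. 0 \<le> a \<and> a < b \<and> b \<le> 1 \<and> {a<..<b} \<inter> P = {} \<longrightarrow>
           (\<exists>(k::int) c. \<forall>t\<in>{a<..<b}. g t = 2 powi k * t + c))) \<and>
     g ` dyadic \<subseteq> dyadic"

definition thompsonT_carrier :: "(real \<Rightarrow> real) set" where
  "thompsonT_carrier =
     {f \<in> Bij circle. \<exists>g. dyadic_PL_lift g \<and> (\<forall>t\<in>circle. f t = frac (g t))}"

text \<open>The product \<open>v \<otimes> u\<close> of \<^const>\<open>BijGroup\<close> is \<open>v \<circ> u\<close>, restricted to \<^const>\<open>circle\<close>.\<close>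

definition thompsonT :: "(real \<Rightarrow> real) monoid" where
  "thompsonT = (BijGroup circle)\<lparr>carrier := thompsonT_carrier\<rparr>"

definition thompsonF :: "(real \<Rightarrow> real) monoid" where
  "thompsonF = thompsonT\<lparr>carrier := {f \<in> carrier thompsonT. f 0 = 0}\<rparr>"

definition x0 :: "real \<Rightarrow> real" where
  "x0 = (\<lambda>t\<in>circle. if t \<le> 1/2 then t / 2 else if t \<le> 3/4 then t - 1/4 else 2 * t - 1)"

definition x1 :: "real \<Rightarrow> real" where
  "x1 = (\<lambda>t\<in>circle. if t \<le> 1/2 then t else 1/2 + 1/2 * x0 (2 * t - 1))"

definition c0 :: "real \<Rightarrow> real" where
  "c0 = (\<lambda>t\<in>circle. frac (t + 1/2))"

text \<open>Length of a shortest word over \<open>S \<union> S\<^sup>-\<^sup>1\<close> representing \<open>w\<close>; only meaningful if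
  \<open>S\<close> generates \<open>w\<close>.\<close>

definition word_length :: "('a, 'b) monoid_scheme \<Rightarrow> 'a set \<Rightarrow> 'a \<Rightarrow> nat" where
  "word_length G S w =
     (LEAST n. \<exists>us. length us = n \<and> set us \<subseteq> S \<union> m_inv G ` S \<and>
        w = foldr (\<lambda>u v. u \<otimes>\<^bsub>G\<^esub> v) us \<one>\<^bsub>G\<^esub>)"

datatype bintree = Leaf | Caret bintree bintree

fun num_carets :: "bintree \<Rightarrow> nat" where
  "num_carets Leaf = 0"
| "num_carets (Caret l r) = Suc (num_carets l + num_carets r)"

fun num_leaves :: "bintree \<Rightarrow> nat" where
  "num_leaves Leaf = 1"
| "num_leaves (Caret l r) = num_leaves l + num_leaves r"

text \<open>Endpoints of the leaf intervals, from left to right, when the root is \<open>[a,b]\<close>.\<close>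

fun leaf_intervals :: "real \<Rightarrow> real \<Rightarrow> bintree \<Rightarrow> (real \<times> real) list" where
  "leaf_intervals a b Leaf = [(a, b)]"
| "leaf_intervals a b (Caret l r) =
     leaf_intervals a ((a + b) / 2) l @ leaf_intervals ((a + b) / 2) b r"

text \<open>The numbers \<open>a\<close> such that some caret has the leaves \<open>a\<close> and \<open>a + 1\<close> as its children.\<close>

fun exposed_carets :: "bintree \<Rightarrow> nat set" where
  "exposed_carets Leaf = {}"
| "exposed_carets (Caret l r) =
     (if l = Leaf \<and> r = Leaf then {0}
      else exposed_carets l \<union> (\<lambda>a. num_leaves l + a) ` exposed_carets r)"

text \<open>Leaf intervals are taken half-open, in accordance with the representation of the circle.\<close>

definition maps_affinely_onto :: "(real \<Rightarrow> real) \<Rightarrow> real \<times> real \<Rightarrow> real \<times> real \<Rightarrow> bool" where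
  "maps_affinely_onto w I J \<longleftrightarrow>
     (\<exists>m c. \<forall>t\<in>{fst I..<snd I}. w t = m * t + c) \<and> w ` {fst I..<snd I} = {fst J..<snd J}"

definition tree_pair_diagram :: "(real \<Rightarrow> real) \<Rightarrow> bintree \<times> bintree \<Rightarrow> bool" where
  "tree_pair_diagram w D \<longleftrightarrow>
     num_leaves (fst D) = num_leaves (snd D) \<and>
     (\<forall>a < num_leaves (fst D).
        maps_affinely_onto w (leaf_intervals 0 1 (fst D) ! a) (leaf_intervals 0 1 (snd D) ! a))"

definition reduced_diagram :: "(real \<Rightarrow> real) \<Rightarrow> bintree \<times> bintree \<Rightarrow> bool" where
  "reduced_diagram w D \<longleftrightarrow>
     tree_pair_diagram w D \<and> exposed_carets (fst D) \<inter> exposed_carets (snd D) = {}"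

text \<open>The choice of the first tree is immaterial: a binary tree with \<open>n\<close> carets has \<open>n + 1\<close>
  leaves, so the two trees of a diagram have equally many carets.\<close>

definition caret_number :: "(real \<Rightarrow> real) \<Rightarrow> nat" where
  "caret_number w = num_carets (fst (THE D. reduced_diagram w D))"

end

theory Submission imports Defs begin

text \<open>
  A word over the generators of \<open>F\<close> is also a word over those of \<open>T\<close>, so only a \<open>T\<close>-word for
  \<open>w\<close> of length \<open>n < |w|\<^sub>F\<close> has to be excluded. For such a word the hypothesis gives
  \<open>N(w) \<ge> n + 2\<close>. The idea is that a word of length \<open>n\<close> can produce \<open>n + 2\<close> carets only if every
  letter is used with maximal efficiency, and that this leaves no room for \<open>c0\<close>.

  Multiplying by a letter on the left acts on the range tree of an (unreduced) diagram by a
  rotation, or by an exchange of the two subtrees of the root for \<open>c0\<close>; beforehand leaves may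
  have to be split to make the required carets available. Starting from one caret, let the range
  tree have the subtrees \<open>L\<close> and \<open>R\<close> at its root. Splitting may add one caret for \<open>x0\<close> and two
  for \<open>x1\<close>, but two only if \<open>R\<close> is a leaf. Hence the weight ``number of carets, minus one if \<open>R\<close>
  is not a leaf'' grows by at most one per letter. It starts at one, so \<open>N(w) \<ge> n + 2\<close> forces it
  to grow at every letter. Now \<open>c0\<close> increases the weight only if \<open>L\<close> is a leaf and \<open>R\<close> is not.
  It makes the new left subtree nontrivial, and from then on every letter that increases the weight
  keeps it so. Therefore \<open>c0\<close> occurs at most once. If it occurs exactly once, then \<open>0\<close> is
  moved to \<open>1/2\<close> by \<open>c0\<close> and never returns, because the other letters fix \<open>0\<close>; this contradicts
  \<open>w \<in> F\<close>. Consequently the word contains no \<open>c0\<close> and \<open>|w|\<^sub>F \<le> n\<close>. This is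
  \<open>word_range_tree\<close>, with the effect of a single letter in \<open>F_letter_weight\<close>.

  Two classical facts connect this with the definitions. First, \<open>N(w)\<close> is at most the
  number of carets of any diagram of \<open>w\<close> (\<open>caret_number_le\<close>): diagrams can be reduced,
  and the reduced one is unique because the leaves of its domain tree are the maximal standard
  dyadic intervals that \<open>w\<close> maps affinely onto standard dyadic intervals. Secondly,
  \<open>x0\<close> and \<open>x1\<close> generate \<open>F\<close> (\<open>thompsonF_word\<close>), without which \<open>|w|\<^sub>F\<close> would be the least
  element of an empty set: every element of \<open>F\<close> has a diagram, and any two trees of the
  same size are connected by the rotations that \<open>x0\<close> and \<open>x1\<close> induce.
\<close>

section \<open>Affine maps between half-open intervals\<close>

text \<open>The increasing affine bijection between half-open intervals. The slope is kept as a witness,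
  not as a quotient, so that it is visibly unchanged when an interval is halved.\<close>

definition carries :: "(real \<Rightarrow> real) \<Rightarrow> real \<times> real \<Rightarrow> real \<times> real \<Rightarrow> bool" where
  "carries f I J \<longleftrightarrow>
     (\<exists>m. m * (snd I - fst I) = snd J - fst J \<and> (\<forall>t\<in>{fst I..<snd I}. f t = fst J + m * (t - fst I)))"

lemma carriesI:
  assumes "m * (b - a) = d - c" "\<And>t. a \<le> t \<Longrightarrow> t < b \<Longrightarrow> f t = c + m * (t - a)"
  shows "carries f (a, b) (c, d)"
  using assms by (auto simp: carries_def)

lemma carriesE:
  assumes "carries f (a, b) (c, d)"
  obtains m where "m * (b - a) = d - c" "\<And>t. a \<le> t \<Longrightarrow> t < b \<Longrightarrow> f t = c + m * (t - a)"
  using assms by (auto simp: carries_def)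

lemma slope_pos:
  fixes a b c d m :: real
  assumes "m * (b - a) = d - c" "a < b" "c < d"
  shows "m > 0"
  using assms by (metis diff_gt_0_iff_gt zero_less_mult_pos2)

lemma carries_mem:
  assumes "carries f (a, b) (c, d)" "a \<le> t" "t < b" "c < d"
  shows "c \<le> f t" "f t < d"
proof -
  obtain m where m: "m * (b - a) = d - c" "f t = c + m * (t - a)"
    using assms by (auto elim: carriesE)
  have "m > 0" using slope_pos[OF m(1)] assms by simp
  then show "c \<le> f t" using m(2) assms by simp
  have "m * (t - a) < m * (b - a)" using \<open>m > 0\<close> assms by simp
  then show "f t < d" using m by simp
qed

lemma carries_left: "carries f (a, b) (c, d) \<Longrightarrow> a < b \<Longrightarrow> f a = c"
  by (auto elim!: carriesE)

text \<open>An affine map onto \<open>[c,d)\<close> cannot have slope \<open>\<le> 0\<close>: its value at \<open>a\<close> would then be a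
  maximum, and \<open>[c,d)\<close> has none. So orientation need not be imposed on the pieces of a
  diagram.\<close>

lemma maps_affinely_onto_iff_carries:
  assumes "a < b" "c < d"
  shows "maps_affinely_onto f (a, b) (c, d) \<longleftrightarrow> carries f (a, b) (c, d)"
proof
  assume *: "carries f (a, b) (c, d)"
  then obtain m where m: "m * (b - a) = d - c" "\<And>t. a \<le> t \<Longrightarrow> t < b \<Longrightarrow> f t = c + m * (t - a)"
    by (auto elim: carriesE)
  have "m > 0" using slope_pos[OF m(1)] assms by simp
  have "\<exists>m k. \<forall>t\<in>{a..<b}. f t = m * t + k"
    using m(2) by (intro exI[of _ m] exI[of _ "c - m * a"]) (auto simp: right_diff_distrib)
  moreover have "y \<in> f ` {a..<b}" if y: "y \<in> {c..<d}" for y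
  proof -
    define t where "t = a + (y - c) / m"
    have "(y - c) / m < b - a"
      using y m(1) \<open>m > 0\<close> by (auto simp: field_simps)
    then have t: "a \<le> t" "t < b"
      using y \<open>m > 0\<close> by (auto simp: t_def)
    then have "f t = y"
      using m(2)[OF t] \<open>m > 0\<close> by (simp add: t_def)
    then show ?thesis using t by auto
  qed
  ultimately show "maps_affinely_onto f (a, b) (c, d)"
    using carries_mem[OF *] assms by (auto simp: maps_affinely_onto_def)
next
  assume "maps_affinely_onto f (a, b) (c, d)"
  then obtain m k where f: "\<And>t. a \<le> t \<Longrightarrow> t < b \<Longrightarrow> f t = m * t + k" and im: "f ` {a..<b} = {c..<d}"
    by (auto simp: maps_affinely_onto_def)
  have fin: "c \<le> m * t + k \<and> m * t + k < d" if "a \<le> t" "t < b" for t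
  proof -
    have "f t \<in> {c..<d}" using im that by auto
    then show ?thesis using f[OF that] by auto
  qed
  have hit: "\<exists>t. a \<le> t \<and> t < b \<and> m * t + k = y" if "c \<le> y" "y < d" for y
  proof -
    have "y \<in> f ` {a..<b}" using im that by auto
    then show ?thesis using f by force
  qed
  have "m > 0"
  proof (rule ccontr)
    assume "\<not> m > 0"
    \<comment> \<open>A value of the target strictly above \<open>f a\<close>, the largest value of \<open>f\<close>.\<close>
    let ?y = "(m * a + k + d) / 2"
    have "c \<le> ?y" "?y < d" using fin[of a] assms by auto
    then obtain t where t: "a \<le> t" "t < b" "m * t + k = ?y" using hit by blast
    have "m * t \<le> m * a" using \<open>\<not> m > 0\<close> t(1) by (intro mult_left_mono_neg) auto
    then show False using t(3) fin[of a] assms by (auto simp: field_simps)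
  qed
  have c: "c = m * a + k"
  proof -
    obtain t where "a \<le> t" "m * t + k = c" using hit[of c] assms by auto
    moreover have "m * a \<le> m * t" using \<open>m > 0\<close> \<open>a \<le> t\<close> by simp
    ultimately show ?thesis using fin[of a] assms by auto
  qed
  have d: "d = m * b + k"
  proof (rule antisym)
    show "d \<le> m * b + k"
    proof (rule ccontr)
      assume "\<not> d \<le> m * b + k"
      moreover have "c \<le> m * b + k" using c \<open>m > 0\<close> assms by auto
      ultimately obtain t where "t < b" "m * t + k = m * b + k" using hit[of "m * b + k"] by auto
      then show False using \<open>m > 0\<close> by auto
    qed
    show "m * b + k \<le> d"
    proof (rule ccontr)
      assume "\<not> m * b + k \<le> d"
      then have "(d - k) / m < b" "a \<le> (d - k) / m"
        using \<open>m > 0\<close> c assms by (auto simp: field_simps)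
      then show False using fin[of "(d - k) / m"] \<open>m > 0\<close> by auto
    qed
  qed
  show "carries f (a, b) (c, d)"
    using f c d by (intro carriesI[of m]) (auto simp: right_diff_distrib)
qed

lemma carries_halves:
  assumes "carries f (a, b) (c, d)" "a < b"
  shows "carries f (a, (a + b) / 2) (c, (c + d) / 2)"
    and "carries f ((a + b) / 2, b) ((c + d) / 2, d)"
proof -
  obtain m where m: "m * (b - a) = d - c" "\<And>t. a \<le> t \<Longrightarrow> t < b \<Longrightarrow> f t = c + m * (t - a)"
    using assms by (auto elim: carriesE)
  have h: "m * ((a + b) / 2 - a) = (c + d) / 2 - c" "m * (b - (a + b) / 2) = d - (c + d) / 2"
    using m(1) by (auto simp: field_simps)
  show "carries f (a, (a + b) / 2) (c, (c + d) / 2)"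
    using h(1) m(2) assms(2) by (intro carriesI[of m]) auto
  have "c + m * (t - a) = (c + d) / 2 + m * (t - (a + b) / 2)" for t
    using h(1) by (simp add: field_simps)
  then show "carries f ((a + b) / 2, b) ((c + d) / 2, d)"
    using h(2) m(2) assms(2) by (intro carriesI[of m]) auto
qed

lemma carries_join:
  assumes "carries f (a, (a + b) / 2) (c, (c + d) / 2)"
    and "carries f ((a + b) / 2, b) ((c + d) / 2, d)" "a < b"
  shows "carries f (a, b) (c, d)"
proof -
  obtain m where m: "m * ((a + b) / 2 - a) = (c + d) / 2 - c"
      "\<And>t. a \<le> t \<Longrightarrow> t < (a + b) / 2 \<Longrightarrow> f t = c + m * (t - a)"
    using assms(1) by (auto elim: carriesE)
  obtain m' where m': "m' * (b - (a + b) / 2) = d - (c + d) / 2"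
      "\<And>t. (a + b) / 2 \<le> t \<Longrightarrow> t < b \<Longrightarrow> f t = (c + d) / 2 + m' * (t - (a + b) / 2)"
    using assms(2) by (auto elim: carriesE)
  have slope: "m * (b - a) = d - c" "m' * (b - a) = d - c"
    using m(1) m'(1) by (auto simp: field_simps)
  then have [simp]: "m' = m"
    using assms(3) by (metis diff_gt_0_iff_gt less_irrefl mult_right_cancel)
  have mid: "(c + d) / 2 + m * (t - (a + b) / 2) = c + m * (t - a)" for t
    using m(1) by (simp add: field_simps)
  have "f t = c + m * (t - a)" if "a \<le> t" "t < b" for t
  proof (cases "t < (a + b) / 2")
    case True
    then show ?thesis using m(2) that by simp
  next
    case False
    then show ?thesis using m'(2)[of t] that mid by simp
  qed
  then show ?thesis using slope(1) by (intro carriesI)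
qed

lemma carries_comp:
  assumes "carries f (a, b) (c, d)" "carries g (c, d) (p, q)" "a < b" "c < d"
    and "\<And>t. a \<le> t \<Longrightarrow> t < b \<Longrightarrow> h t = g (f t)"
  shows "carries h (a, b) (p, q)"
proof -
  obtain m where m: "m * (b - a) = d - c" "\<And>t. a \<le> t \<Longrightarrow> t < b \<Longrightarrow> f t = c + m * (t - a)"
    using assms(1) by (auto elim: carriesE)
  obtain n where n: "n * (d - c) = q - p" "\<And>t. c \<le> t \<Longrightarrow> t < d \<Longrightarrow> g t = p + n * (t - c)"
    using assms(2) by (auto elim: carriesE)
  have "h t = p + n * m * (t - a)" if t: "a \<le> t" "t < b" for t
    using carries_mem[OF assms(1) t assms(4)] n(2)[of "f t"] m(2)[OF t] assms(5)[OF t] by simp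
  moreover have "n * m * (b - a) = q - p" using m(1) n(1) by (simp add: mult.assoc)
  ultimately show ?thesis by (intro carriesI)
qed

text \<open>The right endpoint is outside the domain; the value at the midpoint determines it.\<close>

lemma carries_unique:
  assumes "carries f (a, b) (c, d)" "carries f (a, b) (c', d')" "a < b"
  shows "c = c'" "d = d'"
proof -
  show c: "c = c'" using assms by (metis carries_left)
  have m: "(a + b) / 2 < b" using assms(3) by simp
  have "f ((a + b) / 2) = (c + d) / 2" "f ((a + b) / 2) = (c' + d') / 2"
    using carries_left[OF carries_halves(2)[OF assms(1,3)] m]
      carries_left[OF carries_halves(2)[OF assms(2,3)] m] by auto
  then show "d = d'" using c by simp
qed

lemma carries_eq:
  assumes "carries f (a, b) (c, d)" "carries g (a, b) (c, d)" "a \<le> t" "t < b"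
  shows "f t = g t"
proof -
  obtain m where m: "m * (b - a) = d - c" "f t = c + m * (t - a)"
    using assms by (auto elim: carriesE)
  obtain n where n: "n * (b - a) = d - c" "g t = c + n * (t - a)"
    using assms by (auto elim: carriesE)
  have "m * (b - a) = n * (b - a)" "b - a \<noteq> 0" using m(1) n(1) assms(3,4) by auto
  then show ?thesis using m(2) n(2) by simp
qed

section \<open>Leaf intervals of binary trees\<close>

abbreviation leaves :: "real \<Rightarrow> real \<Rightarrow> bintree \<Rightarrow> (real \<times> real) set" where
  "leaves a b T \<equiv> set (leaf_intervals a b T)"

lemma length_leaf_intervals [simp]: "length (leaf_intervals a b T) = num_leaves T"
  by (induction T arbitrary: a b) auto

lemma num_leaves_eq_Suc_num_carets: "num_leaves T = Suc (num_carets T)"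
  by (induction T) auto

lemma leaf_bounds:
  "a < b \<Longrightarrow> (p, q) \<in> leaves a b T \<Longrightarrow> a \<le> p \<and> p < q \<and> q \<le> b"
proof (induction T arbitrary: a b)
  case (Caret l r)
  have m: "a < (a + b) / 2" "(a + b) / 2 < b" using Caret.prems by auto
  show ?case
    using Caret.prems(2) Caret.IH(1)[OF m(1)] Caret.IH(2)[OF m(2)] m by fastforce
qed auto

lemma leaf_cover:
  "a \<le> t \<Longrightarrow> t < b \<Longrightarrow> \<exists>p q. (p, q) \<in> leaves a b T \<and> p \<le> t \<and> t < q"
proof (induction T arbitrary: a b)
  case (Caret l r)
  show ?case
  proof (cases "t < (a + b) / 2")
    case True
    then show ?thesis using Caret.IH(1)[of a "(a + b) / 2"] Caret.prems by auto
  next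
    case False
    then show ?thesis using Caret.IH(2)[of "(a + b) / 2" b] Caret.prems by auto
  qed
qed auto

lemma sorted_left_endpoints:
  "a < b \<Longrightarrow> sorted_wrt (<) (map fst (leaf_intervals a b T))"
proof (induction T arbitrary: a b)
  case (Caret l r)
  have m: "a < (a + b) / 2" "(a + b) / 2 < b" using Caret.prems by auto
  show ?case
    using Caret.IH(1)[OF m(1)] Caret.IH(2)[OF m(2)] leaf_bounds[OF m(1), of _ _ l]
      leaf_bounds[OF m(2), of _ _ r]
    by (force simp: sorted_wrt_append)
qed auto

lemma leaf_eqI:
  assumes "(p, q) \<in> leaves a b T" "(p, q') \<in> leaves a b T" "a < b"
  shows "q = q'"
proof -
  have "inj_on fst (leaves a b T)"
    using sorted_left_endpoints[OF assms(3)] strict_sorted_iff distinct_map by blast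
  then show ?thesis using assms by (auto dest: inj_onD[of _ _ "(p, q)" "(p, q')"])
qed

lemma leaf_overlap:
  "a < b \<Longrightarrow> (p, q) \<in> leaves a b T \<Longrightarrow> (p', q') \<in> leaves a b T \<Longrightarrow>
     p \<le> t \<Longrightarrow> t < q \<Longrightarrow> p' \<le> t \<Longrightarrow> t < q' \<Longrightarrow> p = p'"
proof (induction T arbitrary: a b)
  case (Caret l r)
  have m: "a < (a + b) / 2" "(a + b) / 2 < b" using Caret.prems by auto
  show ?case
    using Caret.prems Caret.IH(1)[OF m(1)] Caret.IH(2)[OF m(2)]
      leaf_bounds[OF m(1), of _ _ l] leaf_bounds[OF m(2), of _ _ r] by fastforce
qed auto

lemma carries_leaf_intervals:
  "carries f (a, b) (c, d) \<Longrightarrow> a < b \<Longrightarrow>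
     list_all2 (carries f) (leaf_intervals a b T) (leaf_intervals c d T)"
proof (induction T arbitrary: a b c d)
  case (Caret l r)
  have m: "a < (a + b) / 2" "(a + b) / 2 < b" using Caret.prems by auto
  show ?case
    using Caret.IH(1)[OF carries_halves(1)[OF Caret.prems] m(1)]
      Caret.IH(2)[OF carries_halves(2)[OF Caret.prems] m(2)]
    by (auto intro: list_all2_appendI)
qed auto

lemma list_all2_partner: "list_all2 R xs ys \<Longrightarrow> x \<in> set xs \<Longrightarrow> \<exists>y\<in>set ys. R x y"
  by (induction rule: list_all2_induct) auto

text \<open>Subdividing the leaf intervals one at a time, each by a tree of its own, amounts to grafting
  these trees onto the leaves.\<close>

lemma leaves_graft:
  assumes "\<And>p q. (p, q) \<in> leaves a b S \<Longrightarrow> \<exists>U. \<forall>K\<in>leaves p q U. Q K"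
  shows "\<exists>S'. \<forall>K\<in>leaves a b S'. Q K"
  using assms
proof (induction S arbitrary: a b)
  case (Caret l r)
  obtain l' where "\<forall>K\<in>leaves a ((a + b) / 2) l'. Q K"
    using Caret.IH(1)[of a "(a + b) / 2"] Caret.prems by force
  moreover obtain r' where "\<forall>K\<in>leaves ((a + b) / 2) b r'. Q K"
    using Caret.IH(2)[of "(a + b) / 2" b] Caret.prems by force
  ultimately have "\<forall>K\<in>leaves a b (Caret l' r'). Q K" by auto
  then show ?case by blast
qed auto

lemma leaf_intervals_inject:
  "a < b \<Longrightarrow> leaf_intervals a b S = leaf_intervals a b T \<Longrightarrow> S = T"
proof (induction S arbitrary: a b T)
  case Leaf
  then have "num_leaves T = 1" by (metis length_leaf_intervals num_leaves.simps(1))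
  then show ?case by (cases T) (auto simp: num_leaves_eq_Suc_num_carets)
next
  case (Caret l r)
  let ?m = "(a + b) / 2"
  have m: "a < ?m" "?m < b" using Caret.prems by auto
  have "num_leaves T = num_leaves (Caret l r)"
    using Caret.prems by (metis length_leaf_intervals)
  then obtain l' r' where T: "T = Caret l' r'"
    by (cases T) (auto simp: num_leaves_eq_Suc_num_carets)
  \<comment> \<open>Leaf intervals of the left subtree are recognised by their left endpoint.\<close>
  let ?P = "\<lambda>I::real \<times> real. fst I < ?m"
  have L: "filter ?P (leaf_intervals a ?m t) = leaf_intervals a ?m t" 
          "filter (\<lambda>I. \<not> ?P I) (leaf_intervals a ?m t) = []" for t
    using leaf_bounds[OF m(1), of _ _ t] by (fastforce simp: filter_id_conv filter_empty_conv)+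
  have R: "filter ?P (leaf_intervals ?m b t) = []" 
          "filter (\<lambda>I. \<not> ?P I) (leaf_intervals ?m b t) = leaf_intervals ?m b t" for t
    using leaf_bounds[OF m(2), of _ _ t] by (fastforce simp: filter_id_conv filter_empty_conv)+
  have eq: "leaf_intervals a ?m l @ leaf_intervals ?m b r
          = leaf_intervals a ?m l' @ leaf_intervals ?m b r'"
    using Caret.prems(2) T by simp
  have "leaf_intervals a ?m l = leaf_intervals a ?m l'"
    using arg_cong[OF eq, of "filter ?P"] by (simp only: filter_append L R) simp
  moreover have "leaf_intervals ?m b r = leaf_intervals ?m b r'"
    using arg_cong[OF eq, of "filter (\<lambda>I. \<not> ?P I)"] by (simp only: filter_append L R) simp
  ultimately show ?case using Caret.IH m T by blast
qed


section \<open>Diagrams\<close>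

text \<open>Here the \<open>i\<close>-th leaf goes to the \<open>i\<close>-th leaf, as in a tree pair diagram of an element of \<open>F\<close>.\<close>

abbreviation diagram :: "(real \<Rightarrow> real) \<Rightarrow> bintree \<Rightarrow> bintree \<Rightarrow> bool" where
  "diagram f S T \<equiv> list_all2 (carries f) (leaf_intervals 0 1 S) (leaf_intervals 0 1 T)"

lemma tree_pair_diagram_iff: "tree_pair_diagram f (S, T) \<longleftrightarrow> diagram f S T"
proof -
  have "maps_affinely_onto f (leaf_intervals 0 1 S ! i) (leaf_intervals 0 1 T ! i)
      \<longleftrightarrow> carries f (leaf_intervals 0 1 S ! i) (leaf_intervals 0 1 T ! i)"
    if "i < num_leaves S" "num_leaves S = num_leaves T" for i
  proof -
    obtain a b c d where "leaf_intervals 0 1 S ! i = (a, b)" "leaf_intervals 0 1 T ! i = (c, d)"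
      by fastforce
    moreover from this have "(a, b) \<in> leaves 0 1 S" "(c, d) \<in> leaves 0 1 T"
      using that by (metis length_leaf_intervals nth_mem)+
    ultimately show ?thesis
      using maps_affinely_onto_iff_carries leaf_bounds by (metis zero_less_one)
  qed
  then show ?thesis
    by (auto simp: tree_pair_diagram_def list_all2_conv_all_nth)
qed

text \<open>Forgetting the order of the leaves accommodates \<open>c0\<close>, which permutes them cyclically. For a
  bijection the leaves of the range tree are then used exactly once.\<close>

definition moves :: "(real \<Rightarrow> real) \<Rightarrow> bintree \<Rightarrow> bintree \<Rightarrow> bool" where
  "moves f S T \<longleftrightarrow> (\<forall>I\<in>leaves 0 1 S. \<exists>J\<in>leaves 0 1 T. carries f I J)"

lemma diagram_imp_moves: "diagram f S T \<Longrightarrow> moves f S T"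
  using list_all2_partner[of "carries f"] by (simp add: moves_def)

lemma moves_comp:
  assumes "moves f S T" "moves g T U" "\<And>t. 0 \<le> t \<Longrightarrow> t < 1 \<Longrightarrow> h t = g (f t)"
  shows "moves h S U"
  unfolding moves_def
proof
  fix I assume I: "I \<in> leaves 0 1 S"
  then obtain J where J: "J \<in> leaves 0 1 T" "carries f I J" using assms(1) by (auto simp: moves_def)
  then obtain K where K: "K \<in> leaves 0 1 U" "carries g J K" using assms(2) by (auto simp: moves_def)
  obtain a b c d p q where [simp]: "I = (a, b)" "J = (c, d)" "K = (p, q)" by fastforce
  have "carries h I K"
    using carries_comp[of f a b c d g p q h] I J K assms(3) leaf_bounds[of 0 1 a b S]
      leaf_bounds[of 0 1 c d T] by auto
  then show "\<exists>K\<in>leaves 0 1 U. carries h I K" using K by blast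
qed

lemma diagram_comp:
  assumes "diagram f S T" "diagram g T U" "\<And>t. 0 \<le> t \<Longrightarrow> t < 1 \<Longrightarrow> h t = g (f t)"
  shows "diagram h S U"
proof -
  have len: "num_leaves S = num_leaves T" "num_leaves T = num_leaves U"
    using assms by (metis list_all2_lengthD length_leaf_intervals)+
  have "carries h (leaf_intervals 0 1 S ! i) (leaf_intervals 0 1 U ! i)" if i: "i < num_leaves S" for i
  proof -
    obtain a b c d p q where eq: "leaf_intervals 0 1 S ! i = (a, b)" "leaf_intervals 0 1 T ! i = (c, d)"
      "leaf_intervals 0 1 U ! i = (p, q)" by fastforce
    have "(a, b) \<in> leaves 0 1 S" "(c, d) \<in> leaves 0 1 T"
      using eq len i by (metis length_leaf_intervals nth_mem)+
    moreover have "carries f (a, b) (c, d)" "carries g (c, d) (p, q)"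
      using list_all2_nthD[OF assms(1), of i] list_all2_nthD[OF assms(2), of i] i len eq by auto
    ultimately show ?thesis
      using carries_comp[of f a b c d g p q h] assms(3) leaf_bounds[of 0 1 a b S]
      leaf_bounds[of 0 1 c d T] eq by auto
  qed
  then show ?thesis using len by (simp add: list_all2_conv_all_nth)
qed

text \<open>By surjectivity the left endpoints of the leaves of \<open>S\<close> are mapped onto those of \<open>T\<close>; by
  monotonicity the two sorted lists of endpoints then agree entry by entry.\<close>

lemma moves_imp_diagram:
  assumes moves: "moves f S T" and bij: "bij_betw f circle circle" and mono: "strict_mono_on circle f"
  shows "diagram f S T"
proof -
  let ?P = "map fst (leaf_intervals 0 1 S)" and ?Q = "map fst (leaf_intervals 0 1 T)"
  have S: "0 \<le> p \<and> p < q \<and> q \<le> 1" if "(p, q) \<in> leaves 0 1 S" for p q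
    using leaf_bounds[of 0 1 p q S] that by simp
  have T: "0 \<le> p \<and> p < q \<and> q \<le> 1" if "(p, q) \<in> leaves 0 1 T" for p q
    using leaf_bounds[of 0 1 p q T] that by simp
  have sub: "f ` set ?P \<subseteq> set ?Q"
  proof
    fix y assume "y \<in> f ` set ?P"
    then obtain a b where ab: "(a, b) \<in> leaves 0 1 S" "y = f a" by auto
    then obtain c d where cd: "(c, d) \<in> leaves 0 1 T" "carries f (a, b) (c, d)"
      using moves by (auto simp: moves_def)
    then have "y = c" using carries_left S[OF ab(1)] ab(2) by blast
    then show "y \<in> set ?Q" using cd(1) by force
  qed
  have "set ?Q \<subseteq> f ` set ?P"
  proof
    fix c assume "c \<in> set ?Q"
    then obtain d where cd: "(c, d) \<in> leaves 0 1 T" by auto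
    then have "c \<in> circle" using T[of c d] by (auto simp: circle_def)
    then obtain t where t: "t \<in> circle" "f t = c"
      using bij by (metis bij_betw_def imageE)
    then obtain a b where ab: "(a, b) \<in> leaves 0 1 S" "a \<le> t" "t < b"
      using leaf_cover[of 0 t 1 S] by (auto simp: circle_def)
    then have a: "a \<in> circle" using S[OF ab(1)] by (auto simp: circle_def)
    obtain c' d' where cd': "(c', d') \<in> leaves 0 1 T" "carries f (a, b) (c', d')"
      using moves ab by (force simp: moves_def)
    have "c' \<le> c" "c < d'"
      using carries_mem[OF cd'(2) ab(2,3)] T[OF cd'(1)] t by auto
    have "c' = c"
      using leaf_overlap[OF _ cd'(1) cd(1), of c] \<open>c' \<le> c\<close> \<open>c < d'\<close> T[OF cd(1)] by simp
    then have "f a = c" using carries_left[OF cd'(2)] S[OF ab(1)] by auto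
    then show "c \<in> f ` set ?P" using ab(1) by force
  qed
  with sub have "f ` set ?P = set ?Q" by blast
  moreover have "sorted_wrt (<) (map f ?P)"
  proof -
    have circ: "fst I \<in> circle" if "I \<in> leaves 0 1 S" for I
      using S[of "fst I" "snd I"] that by (auto simp: circle_def)
    have "sorted_wrt (<) ?P" using sorted_left_endpoints by simp
    then have "sorted_wrt (\<lambda>I J. f (fst I) < f (fst J)) (leaf_intervals 0 1 S)"
      unfolding sorted_wrt_map
      by (rule sorted_wrt_mono_rel[rotated]) (use circ mono in \<open>auto simp: strict_mono_on_def\<close>)
    then show ?thesis by (simp add: sorted_wrt_map)
  qed
  ultimately have eq: "map f ?P = ?Q"
    by (intro strict_sorted_equal) (auto simp: sorted_left_endpoints)
  then have len: "num_leaves S = num_leaves T"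
    by (metis length_leaf_intervals length_map)
  have "carries f (leaf_intervals 0 1 S ! i) (leaf_intervals 0 1 T ! i)" if i: "i < num_leaves S" for i
  proof -
    obtain a b c d where eq': "leaf_intervals 0 1 S ! i = (a, b)" "leaf_intervals 0 1 T ! i = (c, d)"
      by fastforce
    have ab: "(a, b) \<in> leaves 0 1 S" and cd: "(c, d) \<in> leaves 0 1 T"
      using eq' len i by (metis length_leaf_intervals nth_mem)+
    have "f a = c" using arg_cong[OF eq, of "\<lambda>xs. xs ! i"] eq' i len by simp
    obtain c' d' where cd': "(c', d') \<in> leaves 0 1 T" "carries f (a, b) (c', d')"
      using moves ab by (force simp: moves_def)
    then have "c' = c" using \<open>f a = c\<close> carries_left S[OF ab] by blast
    then have "d' = d" using cd cd'(1) leaf_eqI zero_less_one by blast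
    then show ?thesis using cd'(2) eq' \<open>c' = c\<close> by simp
  qed
  then show ?thesis using len by (simp add: list_all2_conv_all_nth)
qed

section \<open>Reduction of diagrams\<close>

text \<open>The nodes of the infinite binary tree with root \<open>[a,b)\<close>: the intervals that arise from
  \<open>[a,b)\<close> by iterated halving. For \<open>[0,1)\<close> these are the standard dyadic intervals.\<close>

inductive std :: "real \<Rightarrow> real \<Rightarrow> real \<Rightarrow> real \<Rightarrow> bool" where
  std_refl: "std a b a b"
| std_left: "std a ((a + b) / 2) p q \<Longrightarrow> std a b p q"
| std_right: "std ((a + b) / 2) b p q \<Longrightarrow> std a b p q"

lemma std_bounds: "std a b p q \<Longrightarrow> a < b \<Longrightarrow> a \<le> p \<and> p < q \<and> q \<le> b"
  by (induction rule: std.induct) force+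

lemma std_trans: "std a b p q \<Longrightarrow> std p q r s \<Longrightarrow> std a b r s"
  by (induction rule: std.induct) (auto intro: std.intros)

lemma leaf_std: "(p, q) \<in> leaves a b T \<Longrightarrow> std a b p q"
  by (induction T arbitrary: a b) (auto intro: std.intros)

lemma carries_std:
  assumes "std a b p q" "a < b" "carries f (a, b) (c, d)"
  shows "\<exists>r s. std c d r s \<and> carries f (p, q) (r, s)"
  using assms
proof (induction arbitrary: c d rule: std.induct)
  case (std_left a b p q)
  then have "a < (a + b) / 2" by simp
  from std_left.IH[OF this carries_halves(1)[OF std_left.prems(2,1)]] show ?case
    using std.std_left by blast
next
  case (std_right a b p q)
  then have "(a + b) / 2 < b" by simp
  from std_right.IH[OF this carries_halves(2)[OF std_right.prems(2,1)]] show ?case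
    using std.std_right by blast
qed (auto intro: std.intros)

lemma whole_leaf_imp_Leaf:
  assumes "a < b" "(a, b) \<in> leaves a b T"
  shows "T = Leaf"
proof (cases T)
  case (Caret l r)
  have m: "a < (a + b) / 2" "(a + b) / 2 < b" using assms(1) by auto
  show ?thesis
    using assms Caret leaf_bounds[OF m(1), of a b l] leaf_bounds[OF m(2), of a b r] by auto
qed

text \<open>Turning the exposed caret into a leaf \<open>[p,q)\<close> merges two neighbouring entries of the list of
  leaf intervals.\<close>

lemma collapse_exposed_caret:
  assumes "i \<in> exposed_carets T"
  shows "\<exists>xs ys p q T'. length xs = i \<and> std a b p q \<and>
           leaf_intervals a b T = xs @ (p, (p + q) / 2) # ((p + q) / 2, q) # ys \<and>
           leaf_intervals a b T' = xs @ (p, q) # ys"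
  using assms
proof (induction T arbitrary: a b i)
  case (Caret l r)
  let ?m = "(a + b) / 2"
  show ?case
  proof (cases "l = Leaf \<and> r = Leaf")
    case True
    then show ?thesis using Caret.prems
      by (intro exI[of _ "[]"] exI[of _ a] exI[of _ b] exI[of _ Leaf]) (auto intro: std_refl)
  next
    case False
    then consider "i \<in> exposed_carets l" | j where "i = num_leaves l + j" "j \<in> exposed_carets r"
      using Caret.prems by (auto split: if_splits)
    then show ?thesis
    proof cases
      case 1
      from Caret.IH(1)[OF this, of a ?m] obtain xs ys p q T' where *:
        "length xs = i" "std a ?m p q"
        "leaf_intervals a ?m l = xs @ (p, (p + q) / 2) # ((p + q) / 2, q) # ys"
        "leaf_intervals a ?m T' = xs @ (p, q) # ys" by blast
      then show ?thesis
        by (intro exI[of _ xs] exI[of _ "ys @ leaf_intervals ?m b r"] exI[of _ p] exI[of _ q]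
            exI[of _ "Caret T' r"]) (auto intro: std_left)
    next
      case 2
      from Caret.IH(2)[OF 2(2), of ?m b] obtain xs ys p q T' where *:
        "length xs = j" "std ?m b p q"
        "leaf_intervals ?m b r = xs @ (p, (p + q) / 2) # ((p + q) / 2, q) # ys"
        "leaf_intervals ?m b T' = xs @ (p, q) # ys" by blast
      then show ?thesis using 2(1)
        by (intro exI[of _ "leaf_intervals a ?m l @ xs"] exI[of _ ys] exI[of _ p] exI[of _ q]
            exI[of _ "Caret l T'"]) (auto intro: std_right)
    qed
  qed
qed auto

lemma append_block_left:
  assumes "us @ vs = xs @ x # y # ys" "x \<notin> set vs" "y \<notin> set vs"
  shows "\<exists>zs. us = xs @ x # y # zs"
proof -
  have "us @ vs = (xs @ [x, y]) @ ys" using assms(1) by simp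
  then obtain zs where "us = xs @ [x, y] @ zs \<or> us @ zs = xs @ [x, y] \<and> vs = zs @ ys"
    unfolding append_eq_append_conv2 by auto
  then show ?thesis
    using assms(2,3) by (cases zs rule: rev_cases) auto
qed

lemma append_block_right:
  assumes "us @ vs = xs @ x # y # ys" "x \<notin> set us" "y \<notin> set us"
  shows "\<exists>zs. xs = us @ zs \<and> vs = zs @ x # y # ys"
proof -
  obtain zs where "us = xs @ zs \<and> zs @ vs = x # y # ys \<or> us @ zs = xs \<and> vs = zs @ x # y # ys"
    using assms(1) unfolding append_eq_append_conv2 by auto
  then show ?thesis
    using assms(2,3) by (cases zs) auto
qed

text \<open>Neighbouring leaves need not be siblings, but they are if their union is a standard interval.\<close>

lemma sibling_leaves_exposed:
  assumes "leaf_intervals a b T = xs @ (p, (p + q) / 2) # ((p + q) / 2, q) # ys"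
    and "std a b p q" "a < b"
  shows "length xs \<in> exposed_carets T"
  using assms
proof (induction T arbitrary: a b xs ys)
  case Leaf
  from arg_cong[OF Leaf(1), of length] show ?case by simp
next
  case (Caret l r)
  let ?m = "(a + b) / 2" and ?L = "(p, (p + q) / 2)" and ?R = "((p + q) / 2, q)"
  have m: "a < ?m" "?m < b" using Caret.prems by auto
  have pq: "p < q" using std_bounds Caret.prems by blast
  have li: "leaf_intervals a ?m l @ leaf_intervals ?m b r = xs @ ?L # ?R # ys"
    using Caret.prems(1) by simp
  show ?case
    using Caret.prems(2)
  proof cases
    case std_refl
    have "?L \<in> leaves a b (Caret l r)" "?R \<in> leaves a b (Caret l r)"
      using Caret.prems(1) by auto
    then have "?L \<in> leaves a ?m l" "?R \<in> leaves ?m b r"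
      using std_refl leaf_bounds[OF m(1), of ?m b l] leaf_bounds[OF m(2), of a ?m r] m by auto
    then have "l = Leaf" "r = Leaf"
      using whole_leaf_imp_Leaf[OF m(1), of l] whole_leaf_imp_Leaf[OF m(2), of r] std_refl by auto
    then show ?thesis using li by (auto simp: Cons_eq_append_conv)
  next
    case std_left
    have "q \<le> ?m" "p < q" using std_bounds[OF std_left m(1)] by auto
    then have no: "?L \<notin> leaves ?m b r" "?R \<notin> leaves ?m b r"
      using leaf_bounds[OF m(2), of _ _ r] by fastforce+
    have "\<exists>zs. leaf_intervals a ?m l = xs @ ?L # ?R # zs"
      using append_block_left[OF li] no by blast
    then obtain zs where zs: "leaf_intervals a ?m l = xs @ ?L # ?R # zs" by blast
    then have "length xs \<in> exposed_carets l" using Caret.IH(1)[OF zs std_left m(1)] by simp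
    then show ?thesis by auto
  next
    case std_right
    have "?m \<le> p" "p < q" using std_bounds[OF std_right m(2)] by auto
    then have no: "?L \<notin> leaves a ?m l" "?R \<notin> leaves a ?m l"
      using leaf_bounds[OF m(1), of _ _ l] by fastforce+
    have "\<exists>zs. xs = leaf_intervals a ?m l @ zs \<and> leaf_intervals ?m b r = zs @ ?L # ?R # ys"
      using append_block_right[OF li] no by blast
    then obtain zs where zs: "xs = leaf_intervals a ?m l @ zs" "leaf_intervals ?m b r = zs @ ?L # ?R # ys"
      by blast
    then have "length zs \<in> exposed_carets r" using Caret.IH(2)[OF zs(2) std_right m(2)] by simp
    then show ?thesis using zs(1) by auto
  qed
qed

fun caret_intervals :: "real \<Rightarrow> real \<Rightarrow> bintree \<Rightarrow> (real \<times> real) set" where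
  "caret_intervals a b Leaf = {}"
| "caret_intervals a b (Caret l r) =
     insert (a, b) (caret_intervals a ((a + b) / 2) l \<union> caret_intervals ((a + b) / 2) b r)"

lemma caret_std: "(p, q) \<in> caret_intervals a b T \<Longrightarrow> std a b p q"
  by (induction T arbitrary: a b) (auto intro: std.intros)

lemma exposed_carets_nonempty: "T \<noteq> Leaf \<Longrightarrow> exposed_carets T \<noteq> {}"
  by (induction T) auto

text \<open>Every caret has an exposed caret among its descendants or is exposed itself.\<close>

lemma exposed_caret_below:
  assumes "(p, q) \<in> caret_intervals a b T"
  shows "\<exists>xs ys r s. length xs \<in> exposed_carets T \<and> std p q r s \<and>
           leaf_intervals a b T = xs @ (r, (r + s) / 2) # ((r + s) / 2, s) # ys"
  using assms
proof (induction T arbitrary: a b)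
  case (Caret l r)
  let ?m = "(a + b) / 2"
  from Caret.prems consider "p = a" "q = b" | "(p, q) \<in> caret_intervals a ?m l"
    | "(p, q) \<in> caret_intervals ?m b r"
    by auto
  then show ?case
  proof cases
    case 1
    obtain i where "i \<in> exposed_carets (Caret l r)"
      using exposed_carets_nonempty by blast
    then show ?thesis using collapse_exposed_caret[of i "Caret l r" a b] 1 by blast
  next
    case 2
    from Caret.IH(1)[OF this] obtain xs ys u v where *: "length xs \<in> exposed_carets l" "std p q u v"
      "leaf_intervals a ?m l = xs @ (u, (u + v) / 2) # ((u + v) / 2, v) # ys" by blast
    then have "length xs \<in> exposed_carets (Caret l r)" by auto
    then show ?thesis using *
      by (intro exI[of _ xs] exI[of _ "ys @ leaf_intervals ?m b r"] exI[of _ u] exI[of _ v]) simp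
  next
    case 3
    from Caret.IH(2)[OF this] obtain xs ys u v where *: "length xs \<in> exposed_carets r" "std p q u v"
      "leaf_intervals ?m b r = xs @ (u, (u + v) / 2) # ((u + v) / 2, v) # ys" by blast
    then have "length (leaf_intervals a ?m l @ xs) \<in> exposed_carets (Caret l r)" by auto
    then show ?thesis using *
      by (intro exI[of _ "leaf_intervals a ?m l @ xs"] exI[of _ ys] exI[of _ u] exI[of _ v]) simp
  qed
qed auto

text \<open>If the interval of a caret of \<open>S\<close> were carried onto a standard interval, so would be the interval
  of an exposed caret of \<open>S\<close> below it. The images of its two leaves are leaves of \<open>T\<close> and the
  halves of a standard interval, hence an exposed caret of \<open>T\<close> with the same number, and the
  diagram could be reduced.\<close>

lemma reduced_caret_not_carried:
  assumes diag: "diagram f S T" and red: "exposed_carets S \<inter> exposed_carets T = {}"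
    and "(p, q) \<in> caret_intervals 0 1 S"
  shows "\<not> (\<exists>c d. std 0 1 c d \<and> carries f (p, q) (c, d))"
proof
  assume "\<exists>c d. std 0 1 c d \<and> carries f (p, q) (c, d)"
  then obtain c d where cd: "std 0 1 c d" "carries f (p, q) (c, d)" by blast
  obtain xs ys r s where S: "length xs \<in> exposed_carets S" "std p q r s"
      "leaf_intervals 0 1 S = xs @ (r, (r + s) / 2) # ((r + s) / 2, s) # ys"
    using exposed_caret_below[OF assms(3)] by blast
  have "p < q" using std_bounds[OF caret_std[OF assms(3)]] by simp
  then have "r < s" using std_bounds S(2) by blast
  obtain u v where uv: "std c d u v" "carries f (r, s) (u, v)"
    using carries_std[OF S(2) \<open>p < q\<close> cd(2)] by blast
  obtain xs' ys' J K where T: "leaf_intervals 0 1 T = xs' @ J # K # ys'" "length xs' = length xs"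
     "carries f (r, (r + s) / 2) J" "carries f ((r + s) / 2, s) K"
    using diag[unfolded S(3)] by (auto simp: list_all2_append1 list_all2_Cons1)
  have J: "J = (u, (u + v) / 2)"
    using carries_unique[of f r "(r + s) / 2" "fst J" "snd J" u "(u + v) / 2"] T(3)
      carries_halves(1)[OF uv(2) \<open>r < s\<close>] \<open>r < s\<close> by (metis less_half_sum prod.collapse field_less_half_sum)
  have K: "K = ((u + v) / 2, v)"
    using carries_unique[of f "(r + s) / 2" s "fst K" "snd K" "(u + v) / 2" v] T(4)
      carries_halves(2)[OF uv(2) \<open>r < s\<close>] \<open>r < s\<close> by (cases K) auto
  have "length xs' \<in> exposed_carets T"
    using sibling_leaves_exposed[OF T(1)[unfolded J K]] std_trans[OF cd(1) uv(1)] by simp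
  then show False using red S(1) T(2) by auto
qed

text \<open>A tree can be grown from the root if a predicate on intervals tells where to stop.\<close>

lemma tree_determined_by_carets:
  assumes "\<And>p q. (p, q) \<in> caret_intervals a b S \<Longrightarrow> \<not> G p q" "\<And>p q. (p, q) \<in> leaves a b S \<Longrightarrow> G p q"
    and "\<And>p q. (p, q) \<in> caret_intervals a b T \<Longrightarrow> \<not> G p q" "\<And>p q. (p, q) \<in> leaves a b T \<Longrightarrow> G p q"
  shows "S = T"
  using assms
proof (induction S arbitrary: a b T)
  case Leaf
  then show ?case by (cases T) auto
next
  case (Caret l r)
  then obtain l' r' where T: "T = Caret l' r'" by (cases T) auto
  have "l = l'"
    using Caret.prems T by (intro Caret.IH(1)[of a "(a + b) / 2" l']) auto
  moreover have "r = r'"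
    using Caret.prems T by (intro Caret.IH(2)[of "(a + b) / 2" b r']) auto
  ultimately show ?case using T by simp
qed

text \<open>The stopping predicate is ``carried onto a standard interval'': it holds at the leaves of any
  diagram, and at no caret of a reduced one. Hence it determines \<open>S\<close>, and \<open>f\<close> then determines the
  leaf intervals of \<open>T\<close>.\<close>

lemma reduced_diagram_unique:
  assumes "diagram f S T" "exposed_carets S \<inter> exposed_carets T = {}"
    and "diagram f S' T'" "exposed_carets S' \<inter> exposed_carets T' = {}"
  shows "S = S' \<and> T = T'"
proof -
  have leaf: "\<exists>c d. std 0 1 c d \<and> carries f (p, q) (c, d)"
    if "diagram f S T" "(p, q) \<in> leaves 0 1 S" for S T p q
    using diagram_imp_moves[OF that(1)] that(2) leaf_std by (fastforce simp: moves_def)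
  have "S = S'"
    using reduced_caret_not_carried[OF assms(1,2)] reduced_caret_not_carried[OF assms(3,4)]
      leaf[OF assms(1)] leaf[OF assms(3)]
    by (intro tree_determined_by_carets[of 0 1 S "\<lambda>p q. \<exists>c d. std 0 1 c d \<and> carries f (p, q) (c, d)" S'])
  have "leaf_intervals 0 1 T = leaf_intervals 0 1 T'"
  proof (rule nth_equalityI)
    show len: "length (leaf_intervals 0 1 T) = length (leaf_intervals 0 1 T')"
      using assms(1,3) \<open>S = S'\<close> by (metis list_all2_lengthD)
    fix i assume "i < length (leaf_intervals 0 1 T)"
    then have i: "i < num_leaves S" "i < num_leaves T"
      using list_all2_lengthD[OF assms(1)] by simp_all
    obtain a b where ab: "leaf_intervals 0 1 S ! i = (a, b)" by fastforce
    then have "(a, b) \<in> leaves 0 1 S" using i by (metis length_leaf_intervals nth_mem)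
    then have "a < b" using leaf_bounds zero_less_one by blast
    moreover have "carries f (a, b) (leaf_intervals 0 1 T ! i)" "carries f (a, b) (leaf_intervals 0 1 T' ! i)"
      using list_all2_nthD[OF assms(1), of i] list_all2_nthD[OF assms(3), of i] i ab \<open>S = S'\<close> by auto
    ultimately show "leaf_intervals 0 1 T ! i = leaf_intervals 0 1 T' ! i"
      using carries_unique by (metis prod.collapse)
  qed
  then have "T = T'" using leaf_intervals_inject zero_less_one by blast
  with \<open>S = S'\<close> show ?thesis by simp
qed

lemma reduced_diagram_exists:
  assumes "diagram f S T"
  shows "\<exists>S' T'. diagram f S' T' \<and> exposed_carets S' \<inter> exposed_carets T' = {} \<and> num_carets S' \<le> num_carets S"
  using assms
proof (induction "num_carets S" arbitrary: S T rule: less_induct)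
  case less
  show ?case
  proof (cases "exposed_carets S \<inter> exposed_carets T = {}")
    case True
    then show ?thesis using less.prems by blast
  next
    case False
    then obtain i where i: "i \<in> exposed_carets S" "i \<in> exposed_carets T" by blast
    obtain xs ys p q S' where S: "length xs = i" "std 0 1 p q"
        "leaf_intervals 0 1 S = xs @ (p, (p + q) / 2) # ((p + q) / 2, q) # ys"
        "leaf_intervals 0 1 S' = xs @ (p, q) # ys"
      using collapse_exposed_caret[OF i(1)] by blast
    obtain xs' ys' p' q' T' where T: "length xs' = i" "std 0 1 p' q'"
        "leaf_intervals 0 1 T = xs' @ (p', (p' + q') / 2) # ((p' + q') / 2, q') # ys'"
        "leaf_intervals 0 1 T' = xs' @ (p', q') # ys'"
      using collapse_exposed_caret[OF i(2)] by blast
    have "p < q" using std_bounds[OF S(2)] by simp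
    have parts: "list_all2 (carries f) xs xs'" "list_all2 (carries f) ys ys'"
       "carries f (p, (p + q) / 2) (p', (p' + q') / 2)" "carries f ((p + q) / 2, q) ((p' + q') / 2, q')"
      using less.prems S(1) T(1) unfolding S(3) T(3) by (simp_all add: list_all2_append)
    have "diagram f S' T'"
      using parts carries_join[OF parts(3,4) \<open>p < q\<close>] unfolding S(4) T(4)
      by (simp add: list_all2_appendI)
    moreover have "num_leaves S' < num_leaves S"
      using arg_cong[OF S(3), of length] arg_cong[OF S(4), of length] by simp
    then have "num_carets S' < num_carets S" by (simp add: num_leaves_eq_Suc_num_carets)
    ultimately show ?thesis using less.hyps[of S' T'] by (meson le_trans less_imp_le)
  qed
qed

text \<open>Reducing a diagram only removes carets, and by uniqueness every diagram reduces to the same one.\<close>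

lemma caret_number_le:
  assumes "diagram f S T"
  shows "caret_number f \<le> num_carets S"
proof -
  obtain S' T' where *: "diagram f S' T'" "exposed_carets S' \<inter> exposed_carets T' = {}"
      "num_carets S' \<le> num_carets S"
    using reduced_diagram_exists[OF assms] by blast
  have "(THE D. reduced_diagram f D) = (S', T')"
  proof (rule the_equality)
    show "reduced_diagram f (S', T')"
      using * by (simp add: reduced_diagram_def tree_pair_diagram_iff)
    show "D = (S', T')" if "reduced_diagram f D" for D
      using that reduced_diagram_unique[OF _ _ *(1,2)]
      by (cases D) (auto simp: reduced_diagram_def tree_pair_diagram_iff)
  qed
  then show ?thesis using *(3) by (simp add: caret_number_def)
qed

section \<open>Elements of \<open>F\<close> have diagrams\<close>

fun full_tree :: "nat \<Rightarrow> bintree" where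
  "full_tree 0 = Leaf"
| "full_tree (Suc n) = Caret (full_tree n) (full_tree n)"

lemma leaves_full_tree:
  "leaves a b (full_tree n) =
     (\<lambda>i. (a + (b - a) * real i / 2 ^ n, a + (b - a) * real (Suc i) / 2 ^ n)) ` {..<2 ^ n}"
proof (induction n arbitrary: a b)
  case (Suc n)
  let ?m = "(a + b) / 2"
  let ?I = "\<lambda>a b n i. (a + (b - a) * real i / 2 ^ n, a + (b - a) * real (Suc i) / 2 ^ n)"
  have left: "?I a ?m n = ?I a b (Suc n)"
    by (auto simp: fun_eq_iff field_simps)
  have right: "?I ?m b n = (\<lambda>i. ?I a b (Suc n) (2 ^ n + i))"
    by (auto simp: fun_eq_iff field_simps)
  have "{..<2 ^ Suc n} = {..<2 ^ n} \<union> (+) (2 ^ n) ` {..<2 ^ n :: nat}"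
    unfolding lessThan_atLeast0 image_add_atLeastLessThan by auto
  then show ?case
    using left right by (simp only: full_tree.simps leaf_intervals.simps set_append Suc image_Un image_image)
qed (simp add: lessThan_Suc)

lemma dyadic_common_denominator:
  assumes "finite P" "P \<subseteq> dyadic"
  shows "\<exists>m. \<forall>x\<in>P. \<exists>k::int. x = of_int k / 2 ^ m"
proof -
  have "\<forall>\<^sub>F m in sequentially. \<exists>k::int. x = of_int k / 2 ^ m" if "x \<in> P" for x
  proof -
    obtain k n where x: "x = of_int k / 2 ^ n"
      using subsetD[OF assms(2) \<open>x \<in> P\<close>] unfolding dyadic_def by blast
    have "x = of_int (k * 2 ^ (m - n)) / 2 ^ m" if "m \<ge> n" for m
    proof -
      have "(2::real) ^ m = 2 ^ (m - n) * 2 ^ n" using that by (simp flip: power_add)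
      then show ?thesis using x by simp
    qed
    then show ?thesis unfolding eventually_sequentially by blast
  qed
  then have "\<forall>\<^sub>F m in sequentially. \<forall>x\<in>P. \<exists>k::int. x = of_int k / 2 ^ m"
    using assms(1) by (simp add: eventually_ball_finite)
  then show ?thesis unfolding eventually_sequentially by blast
qed

text \<open>The interval is cut into equal parts whose images have length \<open>2 ^ - e\<close>. For large \<open>e\<close> the
  image of the left endpoint is a multiple of \<open>2 ^ - e\<close>, and then every part is carried onto a
  standard interval of depth \<open>e\<close>. Fixing the depth in advance lets the subdivisions of different
  intervals share one range tree.\<close>

lemma subdivide_to_depth:
  assumes f: "carries f (a, b) (c, d)" and "a < b" "0 \<le> c" "d \<le> 1" "c \<in> dyadic" "d - c = 2 powi k"
  shows "\<forall>\<^sub>F e in sequentially. \<exists>U. \<forall>I\<in>leaves a b U. \<exists>J\<in>leaves 0 1 (full_tree e). carries f I J"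
proof -
  obtain p q where pq: "c = of_int p / 2 ^ q" using assms by (auto simp: dyadic_def)
  have "\<exists>U. \<forall>I\<in>leaves a b U. \<exists>J\<in>leaves 0 1 (full_tree e). carries f I J"
    if e: "e \<ge> max q (nat (- k))" for e
  proof -
    \<comment> \<open>Halving \<open>n\<close> times turns the length \<open>2 powi k\<close> of the image into \<open>2 ^ - e\<close>.\<close>
    define n where "n = nat (int e + k)"
    have n: "int n = int e + k" using e by (auto simp: n_def)
    have len: "d - c = 2 ^ n / 2 ^ e"
    proof -
      have "(2::real) powi k = 2 powi (int n - int e)" using n by simp
      also have "\<dots> = 2 ^ n / 2 ^ e" by (simp add: power_int_diff)
      finally show ?thesis using assms by simp
    qed
    define P where "P = nat (p * 2 ^ (e - q))"
    have "c * 2 ^ q = of_int p" using pq by simp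
    then have "0 \<le> real_of_int p" using \<open>0 \<le> c\<close> by (metis mult_nonneg_nonneg zero_le_numeral zero_le_power)
    then have "p \<ge> 0" by simp
    have "(2::real) ^ e = 2 ^ (e - q) * 2 ^ q" using e by (simp flip: power_add)
    then have c: "c = real P / 2 ^ e" using pq \<open>p \<ge> 0\<close> by (simp add: P_def)
    have "real P + 2 ^ n \<le> 2 ^ e"
    proof -
      have "d * 2 ^ e = real P + 2 ^ n" using len c by (simp add: field_simps)
      moreover have "d * 2 ^ e \<le> 1 * 2 ^ e" using \<open>d \<le> 1\<close> by (intro mult_right_mono) auto
      ultimately show ?thesis by simp
    qed
    then have bound: "P + 2 ^ n \<le> 2 ^ e"
      using of_nat_le_iff[where 'a = real, of "P + 2 ^ n" "2 ^ e"] by simp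
    have "\<exists>J\<in>leaves 0 1 (full_tree e). carries f I J" if I: "I \<in> leaves a b (full_tree n)" for I
    proof -
      obtain J where J: "J \<in> leaves c d (full_tree n)" "carries f I J"
        using list_all2_partner[OF carries_leaf_intervals[OF f \<open>a < b\<close>] I] by blast
      then obtain i where i: "i < 2 ^ n"
          "J = (c + (d - c) * real i / 2 ^ n, c + (d - c) * real (Suc i) / 2 ^ n)"
        unfolding leaves_full_tree by auto
      have "J = (real (P + i) / 2 ^ e, real (Suc (P + i)) / 2 ^ e)"
        unfolding i(2) len unfolding c by (simp add: add_divide_distrib)
      moreover have "P + i < 2 ^ e" using i(1) bound by simp
      ultimately have "J \<in> leaves 0 1 (full_tree e)"
        unfolding leaves_full_tree by (intro image_eqI[of _ _ "P + i"]) simp_all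
      then show ?thesis using J(2) by blast
    qed
    then show ?thesis by blast
  qed
  then show ?thesis unfolding eventually_sequentially by blast
qed

text \<open>A lift of an element that fixes \<open>0\<close> differs from it on \<open>[0,1)\<close> by a constant, since no integer is
  crossed.\<close>

lemma thompsonF_lift:
  assumes "w \<in> carrier thompsonF"
  obtains g and z :: int where "dyadic_PL_lift g" "\<And>t. t \<in> circle \<Longrightarrow> w t = g t - of_int z" "w \<in> Bij circle" "w 0 = 0"
proof -
  have w: "w \<in> Bij circle" "w 0 = 0"
    using assms by (auto simp: thompsonF_def thompsonT_def thompsonT_carrier_def)
  obtain g where g: "dyadic_PL_lift g" "\<And>t. t \<in> circle \<Longrightarrow> w t = frac (g t)"
    using assms by (auto simp: thompsonF_def thompsonT_def thompsonT_carrier_def)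
  have "frac (g 0) = 0" using g(2)[of 0] w(2) by (simp add: circle_def)
  then have z: "g 0 = of_int \<lfloor>g 0\<rfloor>" by (simp add: frac_def)
  have "w t = g t - of_int \<lfloor>g 0\<rfloor>" if "t \<in> circle" for t
  proof -
    have "g 0 \<le> g t" "g t < g (0 + 1)"
      using g(1) that by (auto simp: dyadic_PL_lift_def circle_def strict_mono_less strict_mono_less_eq)
    moreover have "g (0 + 1) = g 0 + 1"
      using g(1) unfolding dyadic_PL_lift_def by blast
    ultimately have "g 0 \<le> g t" "g t < g 0 + 1" by simp_all
    then have "\<lfloor>g t\<rfloor> = \<lfloor>g 0\<rfloor>" using z by linarith
    then show ?thesis using g(2)[OF that] by (simp add: frac_def)
  qed
  then show thesis using that g(1) w by blast
qed

lemma thompsonF_strict_mono: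
  assumes "w \<in> carrier thompsonF"
  shows "strict_mono_on circle w"
proof -
  obtain g z where "dyadic_PL_lift g" "\<And>t. t \<in> circle \<Longrightarrow> w t = g t - of_int z"
    using thompsonF_lift[OF assms] by metis
  then show ?thesis by (auto simp: dyadic_PL_lift_def strict_mono_on_def strict_mono_def)
qed

text \<open>Let \<open>2 ^ m\<close> be a common denominator of the breakpoints. The open standard intervals of depth \<open>m\<close>
  contain no breakpoint.\<close>

lemma thompsonF_affine_on_fine_intervals:
  assumes "w \<in> carrier thompsonF"
  shows "\<exists>m. \<forall>(a, b)\<in>leaves 0 1 (full_tree m). \<exists>k c d.
           carries w (a, b) (c, d) \<and> 0 \<le> c \<and> d \<le> 1 \<and> c \<in> dyadic \<and> d - c = 2 powi k"
proof -
  obtain g z where g: "dyadic_PL_lift g" and wg: "\<And>t. t \<in> circle \<Longrightarrow> w t = g t - of_int z"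
      and w: "w \<in> Bij circle"
    using thompsonF_lift[OF assms] by metis
  obtain P where P: "finite P" "P \<subseteq> dyadic"
     "\<And>a b. 0 \<le> a \<Longrightarrow> a < b \<Longrightarrow> b \<le> 1 \<Longrightarrow> {a<..<b} \<inter> P = {} \<Longrightarrow>
        \<exists>(k::int) c. \<forall>t\<in>{a<..<b}. g t = 2 powi k * t + c"
  proof -
    have "\<exists>P. finite P \<and> P \<subseteq> dyadic \<and>
        (\<forall>a b. 0 \<le> a \<and> a < b \<and> b \<le> 1 \<and> {a<..<b} \<inter> P = {} \<longrightarrow>
           (\<exists>(k::int) c. \<forall>t\<in>{a<..<b}. g t = 2 powi k * t + c))"
      using g unfolding dyadic_PL_lift_def by (elim conjE)
    then show thesis using that by (elim exE conjE) presburger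
  qed
  obtain m where m: "\<And>x. x \<in> P \<Longrightarrow> \<exists>k::int. x = of_int k / 2 ^ m"
    using dyadic_common_denominator[OF P(1,2)] by blast
  have "\<exists>k c d. carries w (a, b) (c, d) \<and> 0 \<le> c \<and> d \<le> 1 \<and> c \<in> dyadic \<and> d - c = 2 powi k"
    if ab: "(a, b) \<in> leaves 0 1 (full_tree m)" for a b
  proof -
    obtain i where i: "a = real i / 2 ^ m" "b = real (Suc i) / 2 ^ m"
      using ab unfolding leaves_full_tree by auto
    have bd: "0 \<le> a" "a < b" "b \<le> 1" using leaf_bounds[OF _ ab] by auto
    then have circ: "t \<in> circle" if "a \<le> t" "t < b" for t using that by (auto simp: circle_def)
    have "{a<..<b} \<inter> P = {}"
    proof -
      have False if "x \<in> P" "a < x" "x < b" for x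
      proof -
        obtain j :: int where "x = of_int j / 2 ^ m" using m \<open>x \<in> P\<close> by blast
        then have "real i < of_int j" "of_int j < real (Suc i)"
          using that i by (auto simp: divide_less_cancel)
        then have "int i < j" "j < int (Suc i)" by linarith+
        then show False by linarith
      qed
      then show ?thesis by auto
    qed
    from P(3)[OF bd this] obtain k :: int and h where "\<forall>t\<in>{a<..<b}. g t = 2 powi k * t + h"
      by blast
    then have kh: "g t = 2 powi k * t + h" if "a < t" "t < b" for t
      using that by simp
    \<comment> \<open>The piecewise formula is given on open intervals; continuity extends it to \<open>a\<close>.\<close>
    have "g a = 2 powi k * a + h"
    proof (rule tendsto_unique)
      have "isCont g a" using g by (simp add: dyadic_PL_lift_def continuous_on_eq_continuous_at)
      then show "(g \<longlongrightarrow> g a) (at_right a)"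
        by (auto simp: isCont_def intro: filterlim_mono at_le)
      have "((\<lambda>t. 2 powi k * t + h) \<longlongrightarrow> 2 powi k * a + h) (at_right a)"
        by (intro tendsto_intros)
      moreover have "\<forall>\<^sub>F t in at_right a. 2 powi k * t + h = g t"
        using eventually_at_right_less[of a] eventually_at_right_real[OF bd(2)] 
        by eventually_elim (use kh in auto)
      ultimately show "(g \<longlongrightarrow> 2 powi k * a + h) (at_right a)"
        using Lim_transform_eventually by blast
    qed simp
    then have gt: "g t = 2 powi k * t + h" if "a \<le> t" "t < b" for t
      using kh[of t] that by (cases "t = a") auto
    define d where "d = w a + 2 powi k * (b - a)"
    have wt: "w t = w a + 2 powi k * (t - a)" if "a \<le> t" "t < b" for t
      using wg[OF circ[OF that]] wg[OF circ[OF order_refl bd(2)]] gt[OF that] gt[OF order_refl bd(2)]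
      by (simp add: right_diff_distrib)
    have wc: "carries w (a, b) (w a, d)"
      by (rule carriesI[OF _ wt]) (simp_all add: d_def)
    have wcirc: "0 \<le> w t" "w t < 1" if "a \<le> t" "t < b" for t
      using w circ[OF that] by (auto simp: Bij_def bij_betw_def circle_def)
    have "d \<le> 1"
    proof (rule ccontr)
      assume "\<not> d \<le> 1"
      have pos: "(2::real) powi k > 0" by simp
      \<comment> \<open>The point at which the affine formula takes the value \<open>1\<close>.\<close>
      define t where "t = a + (1 - w a) / 2 powi k"
      have t: "a \<le> t" "t < b"
        using \<open>\<not> d \<le> 1\<close> pos wcirc(2)[of a] bd by (auto simp: t_def d_def field_simps)
      have "w t = 1"
        using wt[OF t] pos by (simp add: t_def)
      then show False using wcirc(2)[OF t] by simp
    qed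
    moreover have "w a \<in> dyadic"
    proof -
      have "a = of_int (int i) / 2 ^ m" using i(1) by simp
      then have "a \<in> dyadic" unfolding dyadic_def by blast
      then have "g a \<in> dyadic" using g by (auto simp: dyadic_PL_lift_def)
      then obtain j :: int and n where "g a = of_int j / 2 ^ n" by (auto simp: dyadic_def)
      then have "w a = of_int (j - z * 2 ^ n) / 2 ^ n"
        using wg[OF circ[OF order_refl bd(2)]] by (simp add: diff_divide_distrib)
      then show ?thesis unfolding dyadic_def by blast
    qed
    moreover have "b - a = 1 / 2 ^ m"
      using i by (simp add: add_divide_distrib)
    then have "d - w a = 2 powi (k - int m)"
      by (simp add: d_def power_int_diff)
    moreover have "0 \<le> w a" using wcirc(1)[of a] bd by simp
    ultimately show ?thesis using wc
      by (intro exI[of _ "k - int m"] exI[of _ "w a"] exI[of _ d] conjI)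
  qed
  then show ?thesis by (intro exI[of _ m]) auto
qed

lemma thompsonF_diagram:
  assumes "w \<in> carrier thompsonF"
  shows "\<exists>S T. diagram w S T"
proof -
  obtain m where m: "\<And>a b. (a, b) \<in> leaves 0 1 (full_tree m) \<Longrightarrow> \<exists>k c d.
           carries w (a, b) (c, d) \<and> 0 \<le> c \<and> d \<le> 1 \<and> c \<in> dyadic \<and> d - c = 2 powi k"
    using thompsonF_affine_on_fine_intervals[OF assms] by blast
  let ?R = "\<lambda>e (a, b). \<exists>U. \<forall>I\<in>leaves a b U. \<exists>J\<in>leaves 0 1 (full_tree e). carries w I J"
  have "\<forall>I\<in>leaves 0 1 (full_tree m). \<forall>\<^sub>F e in sequentially. ?R e I"
  proof
    fix I assume I: "I \<in> leaves 0 1 (full_tree m)"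
    obtain a b where [simp]: "I = (a, b)" by fastforce
    have "a < b" using leaf_bounds[of 0 1 a b "full_tree m"] I by simp
    then show "\<forall>\<^sub>F e in sequentially. ?R e I"
      using m[of a b] I subdivide_to_depth[of w a b] by auto
  qed
  then have "\<forall>\<^sub>F e in sequentially. \<forall>I\<in>leaves 0 1 (full_tree m). ?R e I"
    by (intro eventually_ball_finite) auto
  then obtain e where "\<forall>I\<in>leaves 0 1 (full_tree m). ?R e I"
    unfolding eventually_sequentially by (meson order_refl)
  then have "\<exists>U. \<forall>I\<in>leaves a b U. \<exists>J\<in>leaves 0 1 (full_tree e). carries w I J"
    if "(a, b) \<in> leaves 0 1 (full_tree m)" for a b
    using that by (auto dest: bspec)
  from leaves_graft[of 0 1 "full_tree m", OF this]
  obtain S where "\<forall>I\<in>leaves 0 1 S. \<exists>J\<in>leaves 0 1 (full_tree e). carries w I J" by blast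
  then have "moves w S (full_tree e)" by (simp add: moves_def)
  moreover have "bij_betw w circle circle"
    using assms by (simp add: thompsonF_def thompsonT_def thompsonT_carrier_def Bij_def)
  ultimately show ?thesis
    using moves_imp_diagram thompsonF_strict_mono[OF assms] by blast
qed

section \<open>Words in the generators\<close>

definition x0_inv :: "real \<Rightarrow> real" where
  "x0_inv = (\<lambda>t\<in>circle. if t \<le> 1/4 then 2 * t else if t \<le> 1/2 then t + 1/4 else (t + 1) / 2)"

definition x1_inv :: "real \<Rightarrow> real" where
  "x1_inv = (\<lambda>t\<in>circle. if t \<le> 1/2 then t else if t \<le> 5/8 then 2 * t - 1/2
     else if t \<le> 3/4 then t + 1/8 else (t + 1) / 2)"

lemma x1_eq: "x1 = (\<lambda>t\<in>circle. if t \<le> 1/2 then t else if t \<le> 3/4 then t / 2 + 1/4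
     else if t \<le> 7/8 then t - 1/8 else 2 * t - 1)"
  by (auto simp: x1_def x0_def circle_def restrict_def fun_eq_iff field_simps)

lemma c0_eq: "c0 = (\<lambda>t\<in>circle. if t < 1/2 then t + 1/2 else t - 1/2)"
proof -
  have "frac (t + 1/2) = (if t < 1/2 then t + 1/2 else t - 1/2)" if "t \<in> circle" for t :: real
  proof (cases "t < 1/2")
    case False
    then have "\<lfloor>t + 1/2\<rfloor> = 1" using that by (intro floor_unique) (auto simp: circle_def)
    then show ?thesis using False by (simp add: frac_def)
  qed (use that in \<open>auto simp: frac_eq circle_def\<close>)
  then show ?thesis by (auto simp: c0_def restrict_def fun_eq_iff)
qed

lemma BijI_inverse:
  assumes "f \<in> extensional S" "\<And>t. t \<in> S \<Longrightarrow> f t \<in> S \<and> g (f t) = t" "\<And>t. t \<in> S \<Longrightarrow> g t \<in> S \<and> f (g t) = t"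
  shows "f \<in> Bij S"
  using assms by (auto simp: Bij_def intro!: bij_betw_byWitness[of S g f S])

lemma x0_inverses:
  assumes "t \<in> circle"
  shows "x0 t \<in> circle \<and> x0_inv (x0 t) = t" "x0_inv t \<in> circle \<and> x0 (x0_inv t) = t"
  using assms by (auto simp: x0_def x0_inv_def circle_def field_simps)

lemma x1_inverses:
  assumes "t \<in> circle"
  shows "x1 t \<in> circle \<and> x1_inv (x1 t) = t" "x1_inv t \<in> circle \<and> x1 (x1_inv t) = t"
  using assms by (auto simp: x1_eq x1_inv_def circle_def field_simps)

lemma c0_inverse:
  assumes "t \<in> circle"
  shows "c0 t \<in> circle \<and> c0 (c0 t) = t"
  using assms by (auto simp: c0_eq circle_def)

text \<open>The letters of words over \<open>{x0, x1}\<close>: the explicit inverses are shown in \<open>m_inv_generators\<close> to be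
  the group inverses.\<close>

definition F_letters :: "(real \<Rightarrow> real) set" where
  "F_letters = {x0, x1, x0_inv, x1_inv}"

lemma letters_Bij: "insert c0 F_letters \<subseteq> Bij circle"
proof -
  have ext: "x0 \<in> extensional circle" "x0_inv \<in> extensional circle" "x1 \<in> extensional circle"
      "x1_inv \<in> extensional circle" "c0 \<in> extensional circle"
    by (simp_all add: x0_def x0_inv_def x1_def x1_inv_def c0_def)
  have "x0 \<in> Bij circle" "x0_inv \<in> Bij circle" "x1 \<in> Bij circle" "x1_inv \<in> Bij circle"
      "c0 \<in> Bij circle"
    using BijI_inverse[OF ext(1) x0_inverses] BijI_inverse[OF ext(2) x0_inverses(2,1)]
        BijI_inverse[OF ext(3) x1_inverses] BijI_inverse[OF ext(4) x1_inverses(2,1)]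
        BijI_inverse[OF ext(5) c0_inverse c0_inverse] by blast+
  then show ?thesis by (simp add: F_letters_def)
qed

text \<open>Both groups inherit multiplication and unit from the group of all bijections of the circle, so
  words can be evaluated there.\<close>

abbreviation word_value :: "(real \<Rightarrow> real) list \<Rightarrow> real \<Rightarrow> real" where
  "word_value us \<equiv> foldr (\<lambda>u v. u \<otimes>\<^bsub>BijGroup circle\<^esub> v) us \<one>\<^bsub>BijGroup circle\<^esub>"

lemma word_value_Bij: "set us \<subseteq> Bij circle \<Longrightarrow> word_value us \<in> Bij circle"
proof (induction us)
  case Nil
  show ?case by (simp add: BijGroup_def id_Bij del: restrict_apply)
next
  case (Cons u us)
  then show ?case by (auto simp: BijGroup_def compose_Bij)
qed

lemma word_value_Nil: "t \<in> circle \<Longrightarrow> word_value [] t = t"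
  by (simp add: BijGroup_def)

lemma word_value_Cons:
  "set (u # us) \<subseteq> Bij circle \<Longrightarrow> t \<in> circle \<Longrightarrow> word_value (u # us) t = u (word_value us t)"
  using word_value_Bij[of us] by (simp add: BijGroup_def compose_def)

lemma word_value_circle: "set us \<subseteq> Bij circle \<Longrightarrow> t \<in> circle \<Longrightarrow> word_value us t \<in> circle"
  using word_value_Bij[of us] by (auto simp: Bij_def bij_betw_def)

section \<open>Rotations\<close>

text \<open>The action of the letters of \<open>F\<close> on range trees: \<open>x0\<close> rotates at the root, \<open>x1\<close> at the right
  child of the root.\<close>

inductive rotation :: "(real \<Rightarrow> real) \<Rightarrow> bintree \<Rightarrow> bintree \<Rightarrow> bool" where
  root_right: "rotation x0 (Caret A (Caret B C)) (Caret (Caret A B) C)"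
| root_left: "rotation x0_inv (Caret (Caret A B) C) (Caret A (Caret B C))"
| right_right: "rotation x1 (Caret A (Caret B (Caret C D))) (Caret A (Caret (Caret B C) D))"
| right_left: "rotation x1_inv (Caret A (Caret (Caret B C) D)) (Caret A (Caret B (Caret C D)))"

lemma x0_carries:
  "carries x0 (0, 1/2) (0, 1/4)"
  "carries x0 (1/2, 3/4) (1/4, 1/2)"
  "carries x0 (3/4, 1) (1/2, 1)"
proof -
  show "carries x0 (0, 1/2) (0, 1/4)"
    by (rule carriesI[of "1/2"]) (auto simp: x0_def circle_def field_simps)
  show "carries x0 (1/2, 3/4) (1/4, 1/2)"
    by (rule carriesI[of "1"]) (auto simp: x0_def circle_def field_simps)
  show "carries x0 (3/4, 1) (1/2, 1)"
    by (rule carriesI[of "2"]) (auto simp: x0_def circle_def field_simps)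
qed

lemma x0_inv_carries:
  "carries x0_inv (0, 1/4) (0, 1/2)"
  "carries x0_inv (1/4, 1/2) (1/2, 3/4)"
  "carries x0_inv (1/2, 1) (3/4, 1)"
proof -
  show "carries x0_inv (0, 1/4) (0, 1/2)"
    by (rule carriesI[of "2"]) (auto simp: x0_inv_def circle_def field_simps)
  show "carries x0_inv (1/4, 1/2) (1/2, 3/4)"
    by (rule carriesI[of "1"]) (auto simp: x0_inv_def circle_def field_simps)
  show "carries x0_inv (1/2, 1) (3/4, 1)"
    by (rule carriesI[of "1/2"]) (auto simp: x0_inv_def circle_def field_simps)
qed

lemma x1_carries:
  "carries x1 (0, 1/2) (0, 1/2)"
  "carries x1 (1/2, 3/4) (1/2, 5/8)"
  "carries x1 (3/4, 7/8) (5/8, 3/4)"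
  "carries x1 (7/8, 1) (3/4, 1)"
proof -
  show "carries x1 (0, 1/2) (0, 1/2)"
    by (rule carriesI[of "1"]) (auto simp: x1_eq circle_def field_simps)
  show "carries x1 (1/2, 3/4) (1/2, 5/8)"
    by (rule carriesI[of "1/2"]) (auto simp: x1_eq circle_def field_simps)
  show "carries x1 (3/4, 7/8) (5/8, 3/4)"
    by (rule carriesI[of "1"]) (auto simp: x1_eq circle_def field_simps)
  show "carries x1 (7/8, 1) (3/4, 1)"
    by (rule carriesI[of "2"]) (auto simp: x1_eq circle_def field_simps)
qed

lemma x1_inv_carries:
  "carries x1_inv (0, 1/2) (0, 1/2)"
  "carries x1_inv (1/2, 5/8) (1/2, 3/4)"
  "carries x1_inv (5/8, 3/4) (3/4, 7/8)"
  "carries x1_inv (3/4, 1) (7/8, 1)"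
proof -
  show "carries x1_inv (0, 1/2) (0, 1/2)"
    by (rule carriesI[of "1"]) (auto simp: x1_inv_def circle_def field_simps)
  show "carries x1_inv (1/2, 5/8) (1/2, 3/4)"
    by (rule carriesI[of "2"]) (auto simp: x1_inv_def circle_def field_simps)
  show "carries x1_inv (5/8, 3/4) (3/4, 7/8)"
    by (rule carriesI[of "1"]) (auto simp: x1_inv_def circle_def field_simps)
  show "carries x1_inv (3/4, 1) (7/8, 1)"
    by (rule carriesI[of "1/2"]) (auto simp: x1_inv_def circle_def field_simps)
qed

lemma rotation_diagram: "rotation u S T \<Longrightarrow> diagram u S T"
proof (induction rule: rotation.induct)
  case (root_right A B C)
  show ?case using x0_carries[THEN carries_leaf_intervals] by (simp add: list_all2_appendI)
next
  case (root_left A B C)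
  show ?case using x0_inv_carries[THEN carries_leaf_intervals] by (simp add: list_all2_appendI)
next
  case (right_right A B C D)
  show ?case using x1_carries[THEN carries_leaf_intervals] by (simp add: list_all2_appendI)
next
  case (right_left A B C D)
  show ?case using x1_inv_carries[THEN carries_leaf_intervals] by (simp add: list_all2_appendI)
qed

lemma c0_moves: "moves c0 (Caret A B) (Caret B A)"
proof -
  have 1: "carries c0 (0, 1/2) (1/2, 1)"
    by (rule carriesI[of 1]) (auto simp: c0_eq circle_def)
  have 2: "carries c0 (1/2, 1) (0, 1/2)"
    by (rule carriesI[of 1]) (auto simp: c0_eq circle_def)
  show ?thesis
    using list_all2_partner[OF carries_leaf_intervals[OF 1], of _ A]
      list_all2_partner[OF carries_leaf_intervals[OF 2], of _ B]
    by (fastforce simp: moves_def)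
qed

abbreviation rotates :: "bintree \<Rightarrow> bintree \<Rightarrow> bool" where
  "rotates \<equiv> (\<lambda>S T. \<exists>u. rotation u S T)\<^sup>*\<^sup>*"

text \<open>The inverse of each rotation is again a rotation.\<close>

lemma rotates_sym: "rotates S T \<Longrightarrow> rotates T S"
proof (induction rule: rtranclp_induct)
  case (step T U)
  then have "\<exists>u. rotation u U T"
    by (auto elim!: rotation.cases intro: rotation.intros)
  then show ?case using step.IH by (rule converse_rtranclp_into_rtranclp)
qed simp

lemma rotates_num_leaves: "rotates S T \<Longrightarrow> num_leaves S = num_leaves T"
  by (induction rule: rtranclp_induct) (auto elim!: rotation.cases)

fun left_vine :: "nat \<Rightarrow> bintree" where
  "left_vine 0 = Leaf"
| "left_vine (Suc n) = Caret (left_vine n) Leaf"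

lemma rotates_left_leaf: "\<exists>B'. rotates (Caret A B) (Caret Leaf B')"
proof (induction A arbitrary: B)
  case (Caret A1 A2)
  have "rotates (Caret (Caret A1 A2) B) (Caret A1 (Caret A2 B))"
    by (auto intro: rotation.intros)
  then show ?case using Caret.IH(1)[of "Caret A2 B"] by (meson rtranclp_trans)
qed blast

text \<open>The left subtree serves as a store: a leaf that comes first in \<open>B\<close> is moved to the store by a
  rotation at the root, and if \<open>B\<close> does not begin with a leaf, then rotations at the right child
  make its left subtree smaller. This explains the lexicographic induction on the size of \<open>B\<close> and
  the size of its left subtree. The store remains a left vine.\<close>

lemma rotates_left_vine_aux: "rotates (Caret (left_vine k) B) (left_vine (k + num_leaves B))"
proof (induction "num_carets B" arbitrary: k B rule: less_induct)
  case outer: less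
  show ?case
    using outer
  proof (induction "case B of Leaf \<Rightarrow> 0 | Caret l r \<Rightarrow> num_carets l" arbitrary: B rule: less_induct)
    case inner: less
    show ?case
    proof (cases B)
      case (Caret l r)
      show ?thesis
      proof (cases l)
        case Leaf
        have "rotates (Caret (left_vine k) B) (Caret (left_vine (Suc k)) r)"
          using Caret Leaf by (auto intro!: r_into_rtranclp intro: rotation.intros)
        moreover have "rotates (Caret (left_vine (Suc k)) r) (left_vine (Suc k + num_leaves r))"
          using Caret by (intro inner.prems) simp
        ultimately show ?thesis using Caret Leaf by simp
      next
        case (Caret l1 l2)
        with \<open>B = Caret l r\<close> have B: "B = Caret (Caret l1 l2) r" by simp
        have "rotates (Caret (left_vine k) B) (Caret (left_vine k) (Caret l1 (Caret l2 r)))"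
          using B by (auto intro!: r_into_rtranclp intro: rotation.intros)
        moreover have "rotates (Caret (left_vine k) (Caret l1 (Caret l2 r)))
             (left_vine (k + num_leaves (Caret l1 (Caret l2 r))))"
          using B by (intro inner.hyps inner.prems) auto
        ultimately show ?thesis using B by (simp add: add.assoc)
      qed
    qed simp
  qed
qed

text \<open>Rotations at the root reduce to the case in which the left subtree is a leaf, that is, an empty
  store.\<close>

lemma rotates_left_vine: "rotates T (left_vine (num_carets T))"
proof (cases T)
  case (Caret A B)
  obtain B' where B': "rotates T (Caret (left_vine 0) B')"
    using rotates_left_leaf[of A B] Caret by auto
  have "num_leaves T = 1 + num_leaves B'" using rotates_num_leaves[OF B'] by simp
  then have "num_carets T = num_leaves B'" by (simp add: num_leaves_eq_Suc_num_carets)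
  then show ?thesis using B' rotates_left_vine_aux[of 0 B'] by simp
qed simp

lemma rotates_if_same_size:
  assumes "num_leaves S = num_leaves T"
  shows "rotates S T"
proof -
  have "num_carets S = num_carets T"
    using assms by (simp add: num_leaves_eq_Suc_num_carets)
  then show ?thesis
    using rotates_left_vine[of S] rotates_sym[OF rotates_left_vine[of T]] rtranclp_trans
    by simp
qed

lemma rotates_word:
  assumes "rotates S T"
  shows "\<exists>us. set us \<subseteq> F_letters \<and> diagram (word_value us) S T"
  using assms
proof (induction rule: rtranclp_induct)
  case base
  have "list_all2 (carries (word_value [])) (leaf_intervals 0 1 S) (leaf_intervals 0 1 S)"
    by (intro carries_leaf_intervals carriesI[of 1]) (auto simp: BijGroup_def circle_def)
  then show ?case by (metis empty_set empty_subsetI)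
next
  case (step T U)
  then obtain us u where us: "set us \<subseteq> F_letters" "diagram (word_value us) S T" and u: "rotation u T U"
    by blast
  have "u \<in> F_letters" using u by (auto simp: F_letters_def elim: rotation.cases)
  then have "set (u # us) \<subseteq> Bij circle" using us(1) letters_Bij by auto
  then have "diagram (word_value (u # us)) S U"
    using word_value_Cons by (intro diagram_comp[OF us(2) rotation_diagram[OF u]]) (simp add: circle_def)
  then show ?case using us(1) \<open>u \<in> F_letters\<close> by (metis insert_subset list.simps(15))
qed

section \<open>Generation of \<open>F\<close>\<close>

text \<open>The rotations that turn the domain tree of a diagram of \<open>w\<close> into its range tree give a word with
  the same diagram as \<open>w\<close>, and a diagram determines the map.\<close>

lemma thompsonF_word:
  assumes "w \<in> carrier thompsonF"
  shows "\<exists>us. set us \<subseteq> F_letters \<and> w = word_value us"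
proof -
  obtain S T where ST: "diagram w S T" using thompsonF_diagram[OF assms] by blast
  then have "num_leaves S = num_leaves T" using list_all2_lengthD by force
  then obtain us where us: "set us \<subseteq> F_letters" "diagram (word_value us) S T"
    using rotates_word[OF rotates_if_same_size] by blast
  have "word_value us \<in> Bij circle"
    using us(1) letters_Bij by (intro word_value_Bij) auto
  moreover have "w \<in> Bij circle"
    using assms by (simp add: thompsonF_def thompsonT_def thompsonT_carrier_def)
  moreover have "w t = word_value us t" if t: "t \<in> circle" for t
  proof -
    obtain a b where ab: "(a, b) \<in> leaves 0 1 S" "a \<le> t" "t < b"
      using leaf_cover[of 0 t 1 S] t by (auto simp: circle_def)
    then obtain i where i: "i < num_leaves S" "leaf_intervals 0 1 S ! i = (a, b)"
      by (metis in_set_conv_nth length_leaf_intervals)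
    obtain c d where "leaf_intervals 0 1 T ! i = (c, d)" by fastforce
    then have "carries w (a, b) (c, d)" "carries (word_value us) (a, b) (c, d)"
      using list_all2_nthD[OF ST, of i] list_all2_nthD[OF us(2), of i] i by simp_all
    then show ?thesis using carries_eq ab(2,3) by blast
  qed
  ultimately have "w = word_value us"
    by (intro extensionalityI[of w circle]) (auto simp: Bij_def)
  then show ?thesis using us(1) by blast
qed

section \<open>Inverses of the generators\<close>

lemma dyadic_of_int: "of_int k \<in> dyadic"
proof -
  have "real_of_int k = of_int k / 2 ^ 0" by simp
  then show ?thesis unfolding dyadic_def by blast
qed

lemma dyadic_add:
  assumes "x \<in> dyadic" "y \<in> dyadic"
  shows "x + y \<in> dyadic"
proof -
  obtain k l :: int and m n where "x = of_int k / 2 ^ m" "y = of_int l / 2 ^ n"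
    using assms by (auto simp: dyadic_def)
  then have "x + y = of_int (k * 2 ^ n + l * 2 ^ m) / 2 ^ (m + n)"
    by (simp add: add_divide_distrib power_add)
  then show ?thesis unfolding dyadic_def by blast
qed

lemma dyadic_mult:
  assumes "x \<in> dyadic" "y \<in> dyadic"
  shows "x * y \<in> dyadic"
proof -
  obtain k l :: int and m n where "x = of_int k / 2 ^ m" "y = of_int l / 2 ^ n"
    using assms by (auto simp: dyadic_def)
  then have "x * y = of_int (k * l) / 2 ^ (m + n)"
    by (simp add: power_add)
  then show ?thesis unfolding dyadic_def by blast
qed

lemma dyadic_inverse_powers: "1/2 \<in> dyadic" "1/4 \<in> dyadic" "1/8 \<in> dyadic"
proof -
  have "1/2 = real_of_int 1 / 2 ^ 1" "1/4 = real_of_int 1 / 2 ^ 2" "1/8 = real_of_int 1 / 2 ^ 3"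
    by simp_all
  then show "1/2 \<in> dyadic" "1/4 \<in> dyadic" "1/8 \<in> dyadic"
    unfolding dyadic_def by blast+
qed

text \<open>The lift is the periodic extension \<open>t \<mapsto> \<lfloor>t\<rfloor> + h (frac t)\<close>. It is strictly increasing and
  surjective, and such a function is continuous, so no gluing at the integers is required.\<close>

lemma thompsonFI:
  assumes bij: "h \<in> Bij circle" and mono: "strict_mono_on circle h" and zero: "h 0 = 0"
    and dyad: "\<And>t. t \<in> circle \<Longrightarrow> t \<in> dyadic \<Longrightarrow> h t \<in> dyadic"
    and P: "finite P" "P \<subseteq> dyadic"
    and affine: "\<And>a b. 0 \<le> a \<Longrightarrow> a < b \<Longrightarrow> b \<le> 1 \<Longrightarrow> {a<..<b} \<inter> P = {} \<Longrightarrow>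
                   \<exists>(k::int) c. \<forall>t\<in>{a<..<b}. h t = 2 powi k * t + c"
  shows "h \<in> carrier thompsonF"
proof -
  define g where "g t = of_int \<lfloor>t\<rfloor> + h (frac t)" for t
  have circ: "frac t \<in> circle" for t by (simp add: circle_def frac_lt_1)
  have hc: "h t \<in> circle" if "t \<in> circle" for t
    using bij that by (auto simp: Bij_def bij_betw_def)
  have g_circle: "g t = h t" if "t \<in> circle" for t
  proof -
    have "\<lfloor>t\<rfloor> = 0" "frac t = t" using that by (auto simp: circle_def frac_eq floor_eq_iff)
    then show ?thesis by (simp add: g_def)
  qed
  have bounds: "of_int \<lfloor>t\<rfloor> \<le> g t" "g t < of_int \<lfloor>t\<rfloor> + 1" for t
    using hc[OF circ[of t]] by (auto simp: g_def circle_def)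
  have "strict_mono g"
  proof (rule strict_monoI)
    fix s t :: real assume "s < t"
    show "g s < g t"
    proof (cases "\<lfloor>s\<rfloor> = \<lfloor>t\<rfloor>")
      case True
      then have "frac s < frac t" using \<open>s < t\<close> by (simp add: frac_def)
      then show ?thesis using True mono circ by (simp add: g_def strict_mono_on_def)
    next
      case False
      then have "\<lfloor>s\<rfloor> + 1 \<le> \<lfloor>t\<rfloor>" using \<open>s < t\<close> by linarith
      then have "of_int \<lfloor>s\<rfloor> + 1 \<le> (of_int \<lfloor>t\<rfloor> :: real)" by linarith
      then show ?thesis using bounds(2)[of s] bounds(1)[of t] by linarith
    qed
  qed
  have "surj g"
    unfolding surj_def
  proof
    fix y
    obtain s where s: "s \<in> circle" "h s = frac y"
      using bij circ[of y] by (metis (no_types, lifting) Bij_def IntD2 bij_betw_def imageE mem_Collect_eq)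
    have "\<lfloor>of_int \<lfloor>y\<rfloor> + s\<rfloor> = \<lfloor>y\<rfloor>" "frac (of_int \<lfloor>y\<rfloor> + s) = s"
      using s(1) by (auto simp: circle_def frac_def floor_eq_iff)
    then have "g (of_int \<lfloor>y\<rfloor> + s) = y" using s(2) by (simp add: g_def frac_def)
    then show "\<exists>x. y = g x" by metis
  qed
  have "continuous_on UNIV g"
    using \<open>surj g\<close> \<open>strict_mono g\<close>
    by (intro continuous_onI_mono) (auto simp: strict_mono_less_eq)
  moreover have "g (t + 1) = g t + 1" for t
    by (simp add: g_def frac_def)
  moreover have "\<exists>k c. \<forall>t\<in>{a<..<b}. g t = 2 powi k * t + c"
    if "0 \<le> a" "a < b" "b \<le> 1" "{a<..<b} \<inter> P = {}" for a b
  proof -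
    have "g t = h t" if "t \<in> {a<..<b}" for t
      using that \<open>0 \<le> a\<close> \<open>b \<le> 1\<close> by (intro g_circle) (auto simp: circle_def)
    then show ?thesis using affine[OF that] by simp
  qed
  moreover have "g ` dyadic \<subseteq> dyadic"
  proof clarify
    fix t assume "t \<in> dyadic"
    then have "t + of_int (- \<lfloor>t\<rfloor>) \<in> dyadic" using dyadic_add dyadic_of_int by blast
    then have "frac t \<in> dyadic" by (simp add: frac_def)
    then show "g t \<in> dyadic" unfolding g_def using dyad[OF circ] dyadic_add dyadic_of_int by blast
  qed
  ultimately have lift: "dyadic_PL_lift g"
    unfolding dyadic_PL_lift_def using \<open>strict_mono g\<close> P
    by (intro conjI allI exI[of _ P] impI) blast+
  have "h t = frac (g t)" if "t \<in> circle" for t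
    using g_circle[OF that] hc[OF that] by (auto simp: circle_def frac_eq)
  then show ?thesis
    using lift bij zero by (auto simp: thompsonF_def thompsonT_def thompsonT_carrier_def)
qed

lemma x0_inv_in_thompsonF: "x0_inv \<in> carrier thompsonF"
proof (rule thompsonFI[where P = "{1/4, 1/2}"])
  show "x0_inv \<in> Bij circle" using letters_Bij by (simp add: F_letters_def)
  show "strict_mono_on circle x0_inv"
    by (auto simp: strict_mono_on_def x0_inv_def circle_def)
  show "x0_inv 0 = 0" by (simp add: x0_inv_def circle_def)
  show "x0_inv t \<in> dyadic" if "t \<in> circle" "t \<in> dyadic" for t
    using that dyadic_mult[OF dyadic_of_int[of 2], of t] dyadic_add[of t "1/4"]
      dyadic_mult[of "1/2" "t + 1"] dyadic_add[of t 1] dyadic_of_int[of 1] dyadic_inverse_powers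
    by (auto simp: x0_inv_def)
  show "\<exists>(k::int) c. \<forall>t\<in>{a<..<b}. x0_inv t = 2 powi k * t + c"
    if "0 \<le> a" "a < b" "b \<le> 1" "{a<..<b} \<inter> {1/4, 1/2} = {}" for a b
  proof -
    have "\<not> (a < 1/4 \<and> 1/4 < b)" "\<not> (a < 1/2 \<and> 1/2 < b)" using that(4) by auto
    then consider "b \<le> 1/4" | "1/4 \<le> a" "b \<le> 1/2" | "1/2 \<le> a" by linarith
    then show ?thesis
    proof cases
      case 1
      then show ?thesis using that
        by (intro exI[of _ 1] exI[of _ 0]) (auto simp: x0_inv_def circle_def)
    next
      case 2
      then show ?thesis using that
        by (intro exI[of _ 0] exI[of _ "1/4"]) (auto simp: x0_inv_def circle_def)
    next
      case 3
      then show ?thesis using that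
        by (intro exI[of _ "-1"] exI[of _ "1/2"]) (auto simp: x0_inv_def circle_def power_int_minus field_simps)
    qed
  qed
qed (use dyadic_inverse_powers in auto)

lemma x1_inv_in_thompsonF: "x1_inv \<in> carrier thompsonF"
proof (rule thompsonFI[where P = "{1/2, 1/2 + 1/8, 1/2 + 1/4}"])
  show "x1_inv \<in> Bij circle" using letters_Bij by (simp add: F_letters_def)
  show "strict_mono_on circle x1_inv"
    by (auto simp: strict_mono_on_def x1_inv_def circle_def)
  show "x1_inv 0 = 0" by (simp add: x1_inv_def circle_def)
  show "x1_inv t \<in> dyadic" if "t \<in> circle" "t \<in> dyadic" for t
    using that dyadic_mult[OF dyadic_of_int[of 2], of t] dyadic_add[of t "1/8"]
      dyadic_add[of "2 * t" "- 1 * (1/2)"] dyadic_mult[OF dyadic_of_int[of "-1"], of "1/2"]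
      dyadic_mult[of "1/2" "t + 1"] dyadic_add[of t 1] dyadic_of_int[of 1] dyadic_inverse_powers
    by (auto simp: x1_inv_def)
  show "\<exists>(k::int) c. \<forall>t\<in>{a<..<b}. x1_inv t = 2 powi k * t + c"
    if "0 \<le> a" "a < b" "b \<le> 1" "{a<..<b} \<inter> {1/2, 1/2 + 1/8, 1/2 + 1/4} = {}" for a b
  proof -
    have "\<not> (a < 1/2 \<and> 1/2 < b)" "\<not> (a < 5/8 \<and> 5/8 < b)" "\<not> (a < 3/4 \<and> 3/4 < b)"
      using that(4) by auto
    then consider "b \<le> 1/2" | "1/2 \<le> a" "b \<le> 5/8" | "5/8 \<le> a" "b \<le> 3/4" | "3/4 \<le> a" by linarith
    then show ?thesis
    proof cases
      case 1
      then show ?thesis using that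
        by (intro exI[of _ 0] exI[of _ 0]) (auto simp: x1_inv_def circle_def)
    next
      case 2
      then show ?thesis using that
        by (intro exI[of _ 1] exI[of _ "-1/2"]) (auto simp: x1_inv_def circle_def)
    next
      case 3
      then show ?thesis using that
        by (intro exI[of _ 0] exI[of _ "1/8"]) (auto simp: x1_inv_def circle_def)
    next
      case 4
      then show ?thesis using that
        by (intro exI[of _ "-1"] exI[of _ "1/2"]) (auto simp: x1_inv_def circle_def power_int_minus field_simps)
    qed
  qed
next
  show "{1/2, 1/2 + 1/8, 1/2 + 1/4} \<subseteq> dyadic"
    using dyadic_inverse_powers dyadic_add by blast
qed simp

lemma c0_in_thompsonT: "c0 \<in> carrier thompsonT"
proof -
  have "dyadic_PL_lift (\<lambda>t. t + 1/2)"
    unfolding dyadic_PL_lift_def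
  proof (intro conjI allI exI[of _ "{}"] impI)
    show "strict_mono (\<lambda>t::real. t + 1/2)" by (simp add: strict_mono_def)
    show "\<exists>(k::int) c. \<forall>t\<in>{a<..<b}. t + 1/2 = 2 powi k * t + c" for a b :: real
      by (intro exI[of _ 0] exI[of _ "1/2"]) simp
    show "(\<lambda>t. t + 1/2) ` dyadic \<subseteq> dyadic"
      using dyadic_add dyadic_inverse_powers(1) by blast
  qed (auto intro!: continuous_intros)
  then show ?thesis
    using letters_Bij by (auto simp: thompsonT_def thompsonT_carrier_def c0_def)
qed

text \<open>An inverse is unique already among all bijections of \<open>S\<close>.\<close>

lemma m_inv_restricted_BijGroup:
  assumes "y \<in> C" "C \<subseteq> Bij S" "x \<in> Bij S"
    and "\<And>t. t \<in> S \<Longrightarrow> y (x t) = t" "\<And>t. t \<in> S \<Longrightarrow> x (y t) = t"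
  shows "m_inv ((BijGroup S)\<lparr>carrier := C\<rparr>) x = y"
proof -
  interpret group "BijGroup S" by (rule group_BijGroup)
  have y: "y \<in> carrier (BijGroup S)" and x: "x \<in> carrier (BijGroup S)"
    using assms by (auto simp: BijGroup_def)
  have 1: "y \<otimes>\<^bsub>BijGroup S\<^esub> x = \<one>\<^bsub>BijGroup S\<^esub>" and 2: "x \<otimes>\<^bsub>BijGroup S\<^esub> y = \<one>\<^bsub>BijGroup S\<^esub>"
    using assms x y by (auto simp: BijGroup_def compose_def restrict_def fun_eq_iff)
  show ?thesis
    unfolding m_inv_def
  proof (rule the_equality)
    fix z assume z: "z \<in> carrier (BijGroup S\<lparr>carrier := C\<rparr>) \<and>
      x \<otimes>\<^bsub>BijGroup S\<lparr>carrier := C\<rparr>\<^esub> z = \<one>\<^bsub>BijGroup S\<lparr>carrier := C\<rparr>\<^esub> \<and>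
      z \<otimes>\<^bsub>BijGroup S\<lparr>carrier := C\<rparr>\<^esub> x = \<one>\<^bsub>BijGroup S\<lparr>carrier := C\<rparr>\<^esub>"
    then have "z \<in> carrier (BijGroup S)" using assms(2) by (auto simp: BijGroup_def)
    then have "y = z" using z inv_unique[OF 1 _ x y, of z] by simp
    then show "z = y" by simp
  qed (use assms 1 2 in auto)
qed

lemma thompsonF_eq: "thompsonF = (BijGroup circle)\<lparr>carrier := carrier thompsonF\<rparr>"
  and thompsonT_eq: "thompsonT = (BijGroup circle)\<lparr>carrier := carrier thompsonT\<rparr>"
  by (simp_all add: thompsonF_def thompsonT_def)

lemma carrier_subset:
  "carrier thompsonF \<subseteq> carrier thompsonT" "carrier thompsonT \<subseteq> Bij circle"
  by (auto simp: thompsonF_def thompsonT_def thompsonT_carrier_def)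

lemma m_inv_generators:
  "m_inv thompsonF x0 = x0_inv" "m_inv thompsonF x1 = x1_inv"
  "m_inv thompsonT x0 = x0_inv" "m_inv thompsonT x1 = x1_inv" "m_inv thompsonT c0 = c0"
proof -
  have F: "m_inv thompsonF x = y" if "y \<in> carrier thompsonF" "x \<in> Bij circle"
    "\<And>t. t \<in> circle \<Longrightarrow> y (x t) = t" "\<And>t. t \<in> circle \<Longrightarrow> x (y t) = t" for x y
    using m_inv_restricted_BijGroup[of y "carrier thompsonF" circle x] carrier_subset that
    by (subst thompsonF_eq) blast
  have T: "m_inv thompsonT x = y" if "y \<in> carrier thompsonT" "x \<in> Bij circle"
    "\<And>t. t \<in> circle \<Longrightarrow> y (x t) = t" "\<And>t. t \<in> circle \<Longrightarrow> x (y t) = t" for x y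
    using m_inv_restricted_BijGroup[of y "carrier thompsonT" circle x] carrier_subset that
    by (subst thompsonT_eq) blast
  have B: "x0 \<in> Bij circle" "x1 \<in> Bij circle" "c0 \<in> Bij circle"
    using letters_Bij by (simp_all add: F_letters_def)
  show "m_inv thompsonF x0 = x0_inv" "m_inv thompsonF x1 = x1_inv"
    using F x0_inv_in_thompsonF x1_inv_in_thompsonF B x0_inverses x1_inverses by simp_all
  show "m_inv thompsonT x0 = x0_inv" "m_inv thompsonT x1 = x1_inv" "m_inv thompsonT c0 = c0"
    using T x0_inv_in_thompsonF x1_inv_in_thompsonF c0_in_thompsonT carrier_subset(1) B
      x0_inverses x1_inverses c0_inverse by auto
qed

lemma word_length_thompsonF:
  "word_length thompsonF {x0, x1} w = (LEAST n. \<exists>us. length us = n \<and> set us \<subseteq> F_letters \<and> w = word_value us)"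
proof -
  have "{x0, x1} \<union> m_inv thompsonF ` {x0, x1} = F_letters"
    by (auto simp: F_letters_def m_inv_generators)
  moreover have "mult thompsonF = mult (BijGroup circle)" "one thompsonF = one (BijGroup circle)"
    by (simp_all add: thompsonF_def thompsonT_def)
  ultimately show ?thesis unfolding word_length_def by simp
qed

lemma word_length_thompsonT:
  "word_length thompsonT {x0, x1, c0} w =
     (LEAST n. \<exists>us. length us = n \<and> set us \<subseteq> insert c0 F_letters \<and> w = word_value us)"
proof -
  have "{x0, x1, c0} \<union> m_inv thompsonT ` {x0, x1, c0} = insert c0 F_letters"
    by (auto simp: F_letters_def m_inv_generators)
  moreover have "mult thompsonT = mult (BijGroup circle)" "one thompsonT = one (BijGroup circle)"
    by (simp_all add: thompsonT_def)
  ultimately show ?thesis unfolding word_length_def by simp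
qed

section \<open>Growth of the range tree along a word\<close>

inductive refines :: "bintree \<Rightarrow> bintree \<Rightarrow> bool" where
  refines_Leaf: "refines Leaf T"
| refines_Caret: "refines l l' \<Longrightarrow> refines r r' \<Longrightarrow> refines (Caret l r) (Caret l' r')"

lemma refines_refl: "refines T T"
  by (induction T) (auto intro: refines.intros)

lemma refines_leaf:
  "refines T T' \<Longrightarrow> (p, q) \<in> leaves a b T \<Longrightarrow> \<exists>U. leaves p q U \<subseteq> leaves a b T'"
proof (induction arbitrary: a b rule: refines.induct)
  case (refines_Caret l l' r r')
  then show ?case by fastforce
qed auto

text \<open>The splitting of the range tree is pulled back along \<open>f\<close> to the domain tree. This is why the
  domain tree needs no bookkeeping in what follows.\<close>

lemma moves_refines:
  assumes "moves f S T" "refines T T'"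
  shows "\<exists>S'. moves f S' T'"
proof -
  have "\<exists>U. \<forall>K\<in>leaves p q U. \<exists>J\<in>leaves 0 1 T'. carries f K J" if pq: "(p, q) \<in> leaves 0 1 S" for p q
  proof -
    obtain c d where cd: "(c, d) \<in> leaves 0 1 T" "carries f (p, q) (c, d)"
      using assms(1) pq by (force simp: moves_def)
    obtain U where U: "leaves c d U \<subseteq> leaves 0 1 T'" using refines_leaf[OF assms(2) cd(1)] by blast
    have "p < q" using leaf_bounds[OF _ pq] by simp
    then show ?thesis
      using list_all2_partner[OF carries_leaf_intervals[OF cd(2)], of _ U] U by blast
  qed
  from leaves_graft[of 0 1 S, OF this] show ?thesis by (auto simp: moves_def)
qed

text \<open>The number of carets of \<open>Caret L R\<close>, less one if \<open>R\<close> is not a leaf. The correction offsets the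
  advantage of a leaf \<open>R\<close>, onto which \<open>x1\<close> and its inverse graft two carets at once: afterwards
  \<open>R\<close> is no leaf, and the weight has increased by one only.\<close>

definition weight :: "bintree \<Rightarrow> bintree \<Rightarrow> nat" where
  "weight L R = num_carets L + num_carets R + (if R = Leaf then 1 else 0)"

text \<open>The tree \<open>T\<close> arises from \<open>Caret L R\<close> by splitting just enough leaves for the rotation to apply.
  As to the second claim, only the inverse of \<open>x0\<close> makes the left subtree smaller; when
  \<open>L\<close> is a caret, it adds no caret and does not increase the weight.\<close>

lemma F_letter_weight:
  assumes "u \<in> F_letters"
  shows "\<exists>T L' R'. refines (Caret L R) T \<and> moves u T (Caret L' R') \<and>
           weight L' R' \<le> weight L R + 1 \<and>
           (weight L' R' = weight L R + 1 \<and> L \<noteq> Leaf \<longrightarrow> L' \<noteq> Leaf)"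
proof -
  have step: ?thesis if "rotation u T (Caret L' R')" "refines (Caret L R) T"
      "weight L' R' \<le> weight L R + 1"
      "weight L' R' = weight L R + 1 \<Longrightarrow> L \<noteq> Leaf \<Longrightarrow> L' \<noteq> Leaf" for T L' R'
    using that diagram_imp_moves[OF rotation_diagram] by blast
  note intro = refines.intros refines_refl
  consider "u = x0" | "u = x0_inv" | "u = x1" | "u = x1_inv"
    using assms by (auto simp: F_letters_def)
  then show ?thesis
  proof cases
    case 1
    show ?thesis
    proof (cases R)
      case Leaf
      show ?thesis unfolding 1
        by (rule step[unfolded 1, OF root_right[of L Leaf Leaf]]) (auto simp: Leaf weight_def intro: intro)
    next
      case (Caret B C)
      show ?thesis unfolding 1
        by (rule step[unfolded 1, OF root_right[of L B C]]) (auto simp: Caret weight_def intro: intro)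
    qed
  next
    case 2
    show ?thesis
    proof (cases L)
      case Leaf
      show ?thesis unfolding 2
        by (rule step[unfolded 2, OF root_left[of Leaf Leaf R]]) (auto simp: Leaf weight_def intro: intro)
    next
      case (Caret A B)
      show ?thesis unfolding 2
        by (rule step[unfolded 2, OF root_left[of A B R]]) (auto simp: Caret weight_def intro: intro)
    qed
  next
    case 3
    consider "R = Leaf" | B where "R = Caret B Leaf" | B C D where "R = Caret B (Caret C D)"
      by (metis bintree.exhaust)
    then show ?thesis
    proof cases
      case 1
      show ?thesis unfolding 3
        by (rule step[unfolded 3, OF right_right[of L Leaf Leaf Leaf]]) (auto simp: 1 weight_def intro: intro)
    next
      case 2
      show ?thesis unfolding 3
        by (rule step[unfolded 3, OF right_right[of L B Leaf Leaf]]) (auto simp: 2 weight_def intro: intro)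
    next
      case (3 B C D)
      show ?thesis unfolding \<open>u = x1\<close>
        by (rule step[unfolded \<open>u = x1\<close>, OF right_right[of L B C D]]) (auto simp: 3 weight_def intro: intro)
    qed
  next
    case 4
    consider "R = Leaf" | D where "R = Caret Leaf D" | B C D where "R = Caret (Caret B C) D"
      by (metis bintree.exhaust)
    then show ?thesis
    proof cases
      case 1
      show ?thesis unfolding 4
        by (rule step[unfolded 4, OF right_left[of L Leaf Leaf Leaf]]) (auto simp: 1 weight_def intro: intro)
    next
      case (2 D)
      show ?thesis unfolding 4
        by (rule step[unfolded 4, OF right_left[of L Leaf Leaf D]]) (auto simp: 2 weight_def intro: intro)
    next
      case (3 B C D)
      show ?thesis unfolding 4
        by (rule step[unfolded 4, OF right_left[of L B C D]]) (auto simp: 3 weight_def intro: intro)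
    qed
  qed
qed

lemma F_letter_zero_iff:
  assumes "u \<in> F_letters" "t \<in> circle"
  shows "u t = 0 \<longleftrightarrow> t = 0"
  using assms unfolding F_letters_def
  by (auto simp: x0_def x1_eq x0_inv_def x1_inv_def circle_def split: if_splits)

lemma F_word_zero: "set us \<subseteq> F_letters \<Longrightarrow> word_value us 0 = 0"
proof (induction us)
  case Nil
  show ?case by (rule word_value_Nil) (simp add: circle_def)
next
  case (Cons u us)
  have "set (u # us) \<subseteq> Bij circle" using Cons.prems letters_Bij by auto
  then show ?case
    using word_value_Cons[of u us 0] Cons F_letter_zero_iff[of u 0] by (simp add: circle_def)
qed

text \<open>The invariant behind the theorem. When the bound on the weight is attained, it was attained
  after every suffix of the word, since a letter adds at most one. An occurrence of \<open>c0\<close> then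
  requires a leaf on the left, and a second one is impossible because the first makes the left
  subtree nontrivial for good. A single \<open>c0\<close> takes \<open>0\<close> to \<open>1/2\<close>, and the letters that follow
  fix \<open>0\<close> and are injective.\<close>

lemma word_range_tree:
  assumes "set us \<subseteq> insert c0 F_letters"
  shows "\<exists>S L R. moves (word_value us) S (Caret L R) \<and> weight L R \<le> length us + 1 \<and>
           (weight L R = length us + 1 \<longrightarrow> c0 \<notin> set us \<or> L \<noteq> Leaf \<and> word_value us 0 \<noteq> 0)"
  using assms
proof (induction us)
  case Nil
  have "diagram (word_value []) (Caret Leaf Leaf) (Caret Leaf Leaf)"
    by (intro carries_leaf_intervals carriesI[of 1]) (auto simp: BijGroup_def circle_def)
  then have "moves (word_value []) (Caret Leaf Leaf) (Caret Leaf Leaf)"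
    by (rule diagram_imp_moves)
  then show ?case by (intro exI conjI) (auto simp: weight_def)
next
  case (Cons u us)
  obtain S L R where IH: "moves (word_value us) S (Caret L R)" "weight L R \<le> length us + 1"
      "weight L R = length us + 1 \<Longrightarrow> c0 \<notin> set us \<or> L \<noteq> Leaf \<and> word_value us 0 \<noteq> 0"
    using Cons by auto
  have B: "set (u # us) \<subseteq> Bij circle" using Cons.prems letters_Bij by auto
  have zero: "0 \<in> circle" by (simp add: circle_def)
  have val: "word_value (u # us) 0 = u (word_value us 0)" and circ: "word_value us 0 \<in> circle"
    using word_value_Cons[OF B zero] word_value_circle[of us 0] B zero by auto
  have step: "\<exists>S'. moves (word_value (u # us)) S' T'"
    if ref: "refines (Caret L R) T" and mov: "moves u T T'" for T T'
  proof -
    obtain S' where "moves (word_value us) S' T" using moves_refines[OF IH(1) ref] by blast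
    from moves_comp[OF this mov, of "word_value (u # us)"] show ?thesis
      using word_value_Cons[OF B] by (auto simp: circle_def)
  qed
  show ?case
  proof (cases "u = c0")
    case True
    obtain S' where S': "moves (word_value (u # us)) S' (Caret R L)"
      using step[OF refines_refl] c0_moves True by blast
    have "weight R L \<le> weight L R + 1" by (simp add: weight_def)
    moreover have "R \<noteq> Leaf \<and> word_value (u # us) 0 \<noteq> 0" if "weight R L = length (u # us) + 1"
    proof -
      have tight: "weight L R = length us + 1" "weight R L = weight L R + 1"
        using that IH(2) \<open>weight R L \<le> weight L R + 1\<close> by auto
      then have "L = Leaf" "R \<noteq> Leaf" by (auto simp: weight_def split: if_splits)
      then have "c0 \<notin> set us" using IH(3)[OF tight(1)] by simp
      then have "word_value us 0 = 0" using F_word_zero Cons.prems by auto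
      then have "word_value (u # us) 0 = 1/2" using val True by (simp add: c0_eq circle_def)
      then show ?thesis using \<open>R \<noteq> Leaf\<close> by simp
    qed
    ultimately show ?thesis using S' IH(2)
      by (intro exI[of _ S'] exI[of _ R] exI[of _ L]) auto
  next
    case False
    then have u: "u \<in> F_letters" using Cons.prems by simp
    obtain T L' R' where T: "refines (Caret L R) T" "moves u T (Caret L' R')"
        "weight L' R' \<le> weight L R + 1"
        "weight L' R' = weight L R + 1 \<Longrightarrow> L \<noteq> Leaf \<Longrightarrow> L' \<noteq> Leaf"
      using F_letter_weight[OF u, of L R] by blast
    obtain S' where S': "moves (word_value (u # us)) S' (Caret L' R')" using step T by blast
    have "c0 \<notin> set (u # us) \<or> L' \<noteq> Leaf \<and> word_value (u # us) 0 \<noteq> 0"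
      if "weight L' R' = length (u # us) + 1"
    proof -
      have "weight L R = length us + 1" "weight L' R' = weight L R + 1"
        using that IH(2) T(3) by auto
      then show ?thesis
        using IH(3) T(4) False F_letter_zero_iff[OF u circ] val by auto
    qed
    then show ?thesis using S' IH(2) T(3)
      by (intro exI[of _ S'] exI[of _ L'] exI[of _ R']) auto
  qed
qed

theorem theorem5p3:
  fixes w :: "real \<Rightarrow> real"
  assumes "w \<in> carrier thompsonF"
    and "caret_number w \<ge> word_length thompsonF {x0, x1} w + 1"
  shows "word_length thompsonT {x0, x1, c0} w = word_length thompsonF {x0, x1} w"
proof -
  define F where "F n \<longleftrightarrow> (\<exists>us. length us = n \<and> set us \<subseteq> F_letters \<and> w = word_value us)" for n
  define T where "T n \<longleftrightarrow> (\<exists>us. length us = n \<and> set us \<subseteq> insert c0 F_letters \<and> w = word_value us)" for n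
  have lengths: "word_length thompsonF {x0, x1} w = Least F" "word_length thompsonT {x0, x1, c0} w = Least T"
    unfolding word_length_thompsonF word_length_thompsonT F_def T_def by simp_all
  have "\<exists>n. F n" using thompsonF_word[OF assms(1)] by (auto simp: F_def)
  then have "F (Least F)" by (rule LeastI_ex)
  then obtain vs where vs: "length vs = Least F" "set vs \<subseteq> F_letters" "w = word_value vs"
    unfolding F_def by (elim exE conjE)
  have "set vs \<subseteq> insert c0 F_letters" using vs(2) by (rule subset_insertI2)
  with vs have "T (Least F)" unfolding T_def by (intro exI[of _ vs] conjI)
  then have le: "Least T \<le> Least F" and T: "T (Least T)"
    by (rule Least_le, rule LeastI)
  have "\<not> Least T < Least F"
  proof
    assume less: "Least T < Least F"
    obtain us where us: "length us = Least T" "set us \<subseteq> insert c0 F_letters" "w = word_value us"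
      using T unfolding T_def by metis
    obtain S L R where SLR: "moves w S (Caret L R)" "weight L R \<le> length us + 1"
        "weight L R = length us + 1 \<Longrightarrow> c0 \<notin> set us \<or> w 0 \<noteq> 0"
      using word_range_tree[OF us(2)] unfolding us(3)[symmetric] by metis
    have "w \<in> Bij circle" "w 0 = 0"
      using assms(1) by (auto simp: thompsonF_def thompsonT_def thompsonT_carrier_def)
    then have diag: "diagram w S (Caret L R)"
      using moves_imp_diagram[OF SLR(1)] thompsonF_strict_mono[OF assms(1)] by (simp add: Bij_def)
    have "num_carets S = num_carets (Caret L R)"
      using list_all2_lengthD[OF diag] by (simp only: length_leaf_intervals num_leaves_eq_Suc_num_carets)
    then have "caret_number w \<le> num_carets (Caret L R)" using caret_number_le[OF diag] by simp
    moreover have "caret_number w \<ge> length us + 2"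
      using assms(2) less us(1) unfolding lengths by simp
    ultimately have "weight L R = length us + 1"
      using SLR(2) by (simp add: weight_def split: if_splits)
    then have "c0 \<notin> set us" using SLR(3) \<open>w 0 = 0\<close> by simp
    then have "set us \<subseteq> F_letters" using us(2) by blast
    then have "F (length us)" using us(3) unfolding F_def by metis
    then show False using less us(1) not_less_Least by metis
  qed
  then show ?thesis using le unfolding lengths by simp
qed

end
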